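(* Let $\mathbf{C}$ be an adhesive category which has all pushouts and has final pullback complements of all pairs $(b,c)$ with $c$ a monomorphism. Let $r_1: L_1 \xleftarrow{r_1^-} P_1 \xrightarrow{r_1^+} R_1$ be a rule and $m_1: L_1 \rightarrowtail G_1$ an instance, and let $G_1 \xleftarrow{g_1^-} G_1^- \xrightarrow{g_1^+} G_2$, with $m_1^-: P_1 \rightarrowtail G_1^-$ and $m_1^+: R_1 \rightarrowtail G_2$, be the SqPO rewriting of $G_1$ by $r_1$ through $m_1$. Assume this rewriting is reversible. Let $r_2: L_2 \xleftarrow{r_2^-} P_2 \xrightarrow{r_2^+} R_2$ be a rule and $m_2: L_2 \rightarrowtail G_2$ an instance, and let $G_2 \xleftarrow{g_2^-} G_2^- \xrightarrow{g_2^+} G_3$, with $m_2^-: P_2 \rightarrowtail G_2^-$ and $m_2^+ : R_2 \rightarrowtail G_3$, be the SqPO rewriting of $G_2$ by $r_2$ through $m_2$. Construct: (1) the pullback $R_1 \xleftarrow{x} D \xrightarrow{y} L_2$ of $m_1^+$ and $m_2$ (the overlap $o$); (2) the pushout $R_1 \xrightarrow{r_1^H} H \xleftarrow{l_2^H} L_2$ of $x$ and $y$, and the unique arrow $m^H: H \to G_2$ with $m^H\circ r_1^H = m_1^+$ and $m^H \circ l_2^H = m_2$; (3) the final pullback complement $P_1 \xrightarrow{p_1^H} P_1^H \xrightarrow{h_1^+} H$ of $(r_1^+, r_1^H)$, and the final pullback complement $P_2 \xrightarrow{p_2^H} P_2^H \xrightarrow{h_2^-} H$ of $(r_2^-, l_2^H)$;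 (4) the pushout $L_1 \xrightarrow{l_1^H} L \xleftarrow{h_1^-} P_1^H$ of $r_1^-$ and $p_1^H$, and the pushout $R_2 \xrightarrow{r_2^H} R \xleftarrow{h_2^+} P_2^H$ of $r_2^+$ and $p_2^H$; (5) the pullback $P_1^H \xleftarrow{p'} P \xrightarrow{p''} P_2^H$ of $h_1^+$ and $h_2^-$. The composed rule is $r: L \xleftarrow{h_1^-\circ p'} P \xrightarrow{h_2^+ \circ p''} R$. Let $m_1^H: P_1^H \to G_1^-$ be the unique arrow with $m_1^H \circ p_1^H = m_1^-$ and $g_1^+ \circ m_1^H = m^H \circ h_1^+$, and let $m: L \to G_1$ be the unique arrow with $m \circ l_1^H = m_1$ and $m \circ h_1^- = g_1^- \circ m_1^H$ (a monomorphism). Then the SqPO rewriting of $G_1$ by the rule $r$ through the instance $m$ produces $G_3$: there are $G_1 \xleftarrow{g^-} G_1^{\ominus} \xrightarrow{g^+} G_3$ and $m^-: P \rightarrowtail G_1^{\ominus}$, $m^+: R \rightarrowtail G_3$ such that $(m^-, g^-)$ is a final pullback complement of $(h_1^-\circ p', m)$ and $(m^+, g^+)$ is a pushout of $(m^-, h_2^+\circ p'')$.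
   Context: A final pullback complement (PBC) of a pair of arrows $b: A \to B$, $c: B \to C$ is a pair $a: A \to D$, $d: D \to C$ with $c \circ b = d \circ a$ such that this square is a pullback, and such that for every pullback square $c \circ b' = d' \circ a'$ (with $a': A' \to D'$, $b': A' \to B$, $d': D' \to C$) and every $e: A' \to A$ with $b \circ e = b'$ there is a unique $g: D' \to D$ with $g \circ a' = a \circ e$ and $d \circ g = d'$. A rule is a span $L \xleftarrow{r^-} P \xrightarrow{r^+} R$ in $\mathbf{C}$; an instance of it in an object $G$ is a monomorphism $m: L \rightarrowtail G$. The sesqui-pushout (SqPO) rewriting of $G$ by the rule through $m$ consists of: a final pullback complement $P \xrightarrow{m^-} G^- \xrightarrow{g^-} G$ of $(r^-, m)$, followed by the pushout $G^- \xrightarrow{g^+} G^+ \xleftarrow{m^+} R$ of $m^-$ and $r^+$; $G^+$ is the result, and $m^+$ is the right-hand side instance. Such a rewriting is reversible if the square $m\circ r^- = g^- \circ m^-$ is also a pushout and $(m^-, g^+)$ is also a final pullback complement of $(r^+, m^+)$. *)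

theory Defs
  imports Main
begin

record ('o, 'a) category_data =
  Obj :: "'o set"
  Arr :: "'a set"
  Dom :: "'a \<Rightarrow> 'o"
  Cod :: "'a \<Rightarrow> 'o"
  Id :: "'o \<Rightarrow> 'a"
  Comp :: "'a \<Rightarrow> 'a \<Rightarrow> 'a" (infixr "\<cdot>\<index>" 70)

text \<open>Composition is in the usual order: \<open>g \<cdot>\<^bsub>C\<^esub> f\<close> is ``\<open>g\<close> after \<open>f\<close>'', and is meaningful only if
  \<open>Cod C f = Dom C g\<close>.\<close>

locale category =
  fixes C (structure)
  assumes Dom_Obj: "f \<in> Arr C \<Longrightarrow> Dom C f \<in> Obj C"
    and Cod_Obj: "f \<in> Arr C \<Longrightarrow> Cod C f \<in> Obj C"
    and Id_Arr: "A \<in> Obj C \<Longrightarrow> Id C A \<in> Arr C"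
    and Dom_Id: "A \<in> Obj C \<Longrightarrow> Dom C (Id C A) = A"
    and Cod_Id: "A \<in> Obj C \<Longrightarrow> Cod C (Id C A) = A"
    and Comp_Arr: "\<lbrakk>f \<in> Arr C; g \<in> Arr C; Cod C f = Dom C g\<rbrakk> \<Longrightarrow> g \<cdot> f \<in> Arr C"
    and Dom_Comp: "\<lbrakk>f \<in> Arr C; g \<in> Arr C; Cod C f = Dom C g\<rbrakk> \<Longrightarrow> Dom C (g \<cdot> f) = Dom C f"
    and Cod_Comp: "\<lbrakk>f \<in> Arr C; g \<in> Arr C; Cod C f = Dom C g\<rbrakk> \<Longrightarrow> Cod C (g \<cdot> f) = Cod C g"
    and Comp_Id: "f \<in> Arr C \<Longrightarrow> f \<cdot> Id C (Dom C f) = f"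
    and Id_Comp: "f \<in> Arr C \<Longrightarrow> Id C (Cod C f) \<cdot> f = f"
    and Comp_assoc: "\<lbrakk>f \<in> Arr C; g \<in> Arr C; h \<in> Arr C; Cod C f = Dom C g; Cod C g = Dom C h\<rbrakk>
      \<Longrightarrow> (h \<cdot> g) \<cdot> f = h \<cdot> (g \<cdot> f)"

definition hom :: "('o, 'a, 'z) category_data_scheme \<Rightarrow> 'o \<Rightarrow> 'o \<Rightarrow> 'a set" where
  "hom C A B = {f \<in> Arr C. Dom C f = A \<and> Cod C f = B}"

definition is_the_unique :: "('b \<Rightarrow> bool) \<Rightarrow> 'b \<Rightarrow> bool" where
  "is_the_unique Q u \<longleftrightarrow> Q u \<and> (\<forall>v. Q v \<longrightarrow> v = u)"

definition monomorphism :: "('o, 'a, 'z) category_data_scheme \<Rightarrow> 'a \<Rightarrow> bool" where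
  "monomorphism C f \<longleftrightarrow> f \<in> Arr C \<and>
    (\<forall>g h. g \<in> Arr C \<and> h \<in> Arr C \<and> Dom C g = Dom C h \<and>
       Cod C g = Dom C f \<and> Cod C h = Dom C f \<and> f \<cdot>\<^bsub>C\<^esub> g = f \<cdot>\<^bsub>C\<^esub> h \<longrightarrow> g = h)"

text \<open>In all square predicates the first two arrows \<open>p, q\<close> form the span and the last two
  arrows \<open>f, g\<close> form the cospan, with \<open>f \<cdot>\<^bsub>C\<^esub> p = g \<cdot>\<^bsub>C\<^esub> q\<close>.\<close>

definition commuting_square ::
  "('o, 'a, 'z) category_data_scheme \<Rightarrow> 'a \<Rightarrow> 'a \<Rightarrow> 'a \<Rightarrow> 'a \<Rightarrow> bool" where
  "commuting_square C p q f g \<longleftrightarrow>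
    {p, q, f, g} \<subseteq> Arr C \<and> Dom C p = Dom C q \<and> Cod C p = Dom C f \<and> Cod C q = Dom C g \<and>
    Cod C f = Cod C g \<and> f \<cdot>\<^bsub>C\<^esub> p = g \<cdot>\<^bsub>C\<^esub> q"

definition is_pullback ::
  "('o, 'a, 'z) category_data_scheme \<Rightarrow> 'a \<Rightarrow> 'a \<Rightarrow> 'a \<Rightarrow> 'a \<Rightarrow> bool" where
  "is_pullback C p q f g \<longleftrightarrow> commuting_square C p q f g \<and>
    (\<forall>p' q'. commuting_square C p' q' f g \<longrightarrow>
      (\<exists>!u. u \<in> hom C (Dom C p') (Dom C p) \<and> p \<cdot>\<^bsub>C\<^esub> u = p' \<and> q \<cdot>\<^bsub>C\<^esub> u = q'))"

definition is_pushout ::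
  "('o, 'a, 'z) category_data_scheme \<Rightarrow> 'a \<Rightarrow> 'a \<Rightarrow> 'a \<Rightarrow> 'a \<Rightarrow> bool" where
  "is_pushout C p q f g \<longleftrightarrow> commuting_square C p q f g \<and>
    (\<forall>f' g'. commuting_square C p q f' g' \<longrightarrow>
      (\<exists>!u. u \<in> hom C (Cod C f) (Cod C f') \<and> u \<cdot>\<^bsub>C\<^esub> f = f' \<and> u \<cdot>\<^bsub>C\<^esub> g = g'))"

text \<open>\<open>van_kampen C m f g n\<close>: the square with span \<open>m, f\<close> and cospan \<open>g, n\<close> is the bottom face of
  the cubes considered; \<open>m', f', g', n'\<close> is the top face and \<open>a, b, c, d\<close> are the vertical arrows
  into \<open>Cod C f\<close>, \<open>Cod C m\<close>, \<open>Dom C m\<close> and \<open>Cod C g\<close>, respectively.\<close>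

definition van_kampen ::
  "('o, 'a, 'z) category_data_scheme \<Rightarrow> 'a \<Rightarrow> 'a \<Rightarrow> 'a \<Rightarrow> 'a \<Rightarrow> bool" where
  "van_kampen C m f g n \<longleftrightarrow> is_pushout C m f g n \<and>
    (\<forall>m' f' g' n' a b c d.
      commuting_square C m' f' g' n' \<and>
      is_pullback C m' c b m \<and> is_pullback C f' c a f \<and>
      commuting_square C g' b d g \<and> commuting_square C n' a d n \<longrightarrow>
      (is_pushout C m' f' g' n' \<longleftrightarrow> is_pullback C g' b d g \<and> is_pullback C n' a d n))"

locale adhesive_category = category +
  assumes has_pullbacks:
      "\<lbrakk>f \<in> Arr C; g \<in> Arr C; Cod C f = Cod C g\<rbrakk> \<Longrightarrow> \<exists>p q. is_pullback C p q f g"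
    and has_pushouts_along_monos:
      "\<lbrakk>monomorphism C m; f \<in> Arr C; Dom C m = Dom C f\<rbrakk> \<Longrightarrow> \<exists>g n. is_pushout C m f g n"
    and pushouts_along_monos_van_kampen:
      "\<lbrakk>is_pushout C m f g n; monomorphism C m\<rbrakk> \<Longrightarrow> van_kampen C m f g n"

definition has_all_pushouts :: "('o, 'a, 'z) category_data_scheme \<Rightarrow> bool" where
  "has_all_pushouts C \<longleftrightarrow>
    (\<forall>p q. p \<in> Arr C \<and> q \<in> Arr C \<and> Dom C p = Dom C q \<longrightarrow> (\<exists>f g. is_pushout C p q f g))"

text \<open>\<open>final_pbc C b c a d\<close>: the pair \<open>a, d\<close> is a final pullback complement of the pair \<open>b, c\<close>.\<close>

definition final_pbc ::
  "('o, 'a, 'z) category_data_scheme \<Rightarrow> 'a \<Rightarrow> 'a \<Rightarrow> 'a \<Rightarrow> 'a \<Rightarrow> bool" where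
  "final_pbc C b c a d \<longleftrightarrow> is_pullback C b a c d \<and>
    (\<forall>b' a' d' e. is_pullback C b' a' c d' \<and> e \<in> hom C (Dom C b') (Dom C b) \<and> b \<cdot>\<^bsub>C\<^esub> e = b' \<longrightarrow>
      (\<exists>!g. g \<in> hom C (Dom C d') (Dom C d) \<and> g \<cdot>\<^bsub>C\<^esub> a' = a \<cdot>\<^bsub>C\<^esub> e \<and> d \<cdot>\<^bsub>C\<^esub> g = d'))"

definition has_final_pbcs_over_monos :: "('o, 'a, 'z) category_data_scheme \<Rightarrow> bool" where
  "has_final_pbcs_over_monos C \<longleftrightarrow>
    (\<forall>b c. b \<in> Arr C \<and> monomorphism C c \<and> Cod C b = Dom C c \<longrightarrow> (\<exists>a d. final_pbc C b c a d))"

text \<open>A rule \<open>L \<leftarrow> P \<rightarrow> R\<close> is given by its two legs \<open>rm : P \<rightarrow> L\<close> and \<open>rp : P \<rightarrow> R\<close>.\<close>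

definition rule :: "('o, 'a, 'z) category_data_scheme \<Rightarrow> 'a \<Rightarrow> 'a \<Rightarrow> bool" where
  "rule C rm rp \<longleftrightarrow> rm \<in> Arr C \<and> rp \<in> Arr C \<and> Dom C rm = Dom C rp"

definition rule_instance :: "('o, 'a, 'z) category_data_scheme \<Rightarrow> 'a \<Rightarrow> 'a \<Rightarrow> 'a \<Rightarrow> bool" where
  "rule_instance C rm rp m \<longleftrightarrow> rule C rm rp \<and> monomorphism C m \<and> Dom C m = Cod C rm"

text \<open>Sesqui-pushout rewriting of \<open>G = Cod C m\<close> by the rule \<open>rm, rp\<close> through \<open>m\<close>, with
  \<open>mm : P \<rightarrow> G\<^sup>-\<close>, \<open>gm : G\<^sup>- \<rightarrow> G\<close>, \<open>gp : G\<^sup>- \<rightarrow> G\<^sup>+\<close>, \<open>mp : R \<rightarrow> G\<^sup>+\<close>.\<close>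

definition sqpo_rewriting ::
  "('o, 'a, 'z) category_data_scheme \<Rightarrow> 'a \<Rightarrow> 'a \<Rightarrow> 'a \<Rightarrow> 'a \<Rightarrow> 'a \<Rightarrow> 'a \<Rightarrow> 'a \<Rightarrow> bool" where
  "sqpo_rewriting C rm rp m mm gm gp mp \<longleftrightarrow>
    rule_instance C rm rp m \<and> final_pbc C rm m mm gm \<and> is_pushout C mm rp gp mp"

definition reversible_sqpo_rewriting ::
  "('o, 'a, 'z) category_data_scheme \<Rightarrow> 'a \<Rightarrow> 'a \<Rightarrow> 'a \<Rightarrow> 'a \<Rightarrow> 'a \<Rightarrow> 'a \<Rightarrow> 'a \<Rightarrow> bool" where
  "reversible_sqpo_rewriting C rm rp m mm gm gp mp \<longleftrightarrow>
    sqpo_rewriting C rm rp m mm gm gp mp \<and>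
    is_pushout C rm mm m gm \<and> final_pbc C rp mp mm gp"

end

theory Submission
  imports Defs
begin

text \<open>
  The overlap \<open>H\<close> embeds into \<open>G\<^sub>2\<close> by \<open>m\<^sup>H\<close>, since unions of subobjects are effective in an adhesive
  category. Both rewriting steps factor through \<open>m\<^sup>H\<close>: a final pullback complement along \<open>n \<cdot> c\<close> with
  \<open>n\<close> mono splits into one along \<open>c\<close> and one along \<open>n\<close>, and pushouts split accordingly. Hence
  \<open>G\<^sub>3\<close> arises from \<open>G\<^sub>2\<close> by applying \<open>H \<leftarrow> P\<^sub>2\<^sup>H \<rightarrow> R\<close> through \<open>m\<^sup>H\<close>, and the square over \<open>L \<leftarrow> P\<^sub>1\<^sup>H\<close> is
  a final pullback complement. Reversibility makes the square over \<open>P\<^sub>1\<^sup>H \<rightarrow> H\<close> both a pullback and,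
  by van Kampen and cancellation, a pushout. The object \<open>G\<^sub>1\<^sup>\<ominus>\<close> is the pullback of \<open>g\<^sub>1\<^sup>+\<close> and \<open>g\<^sub>2\<^sup>-\<close>;
  stability under pullback of final pullback complements and of pushouts along monos provides the two
  missing squares over \<open>P\<close>, and composing squares finishes the proof.
\<close>

subsection \<open>Pullbacks and pushouts\<close>

context category
begin

section \<open>Typed composition in hom-sets\<close>

lemma comp_hom: "f \<in> hom C X Y \<Longrightarrow> g \<in> hom C Y Z \<Longrightarrow> g \<cdot> f \<in> hom C X Z"
  by (simp add: hom_def Comp_Arr Dom_Comp Cod_Comp)

lemma comp_assoc:
  "f \<in> hom C X Y \<Longrightarrow> g \<in> hom C Y Z \<Longrightarrow> h \<in> hom C Z W \<Longrightarrow> (h \<cdot> g) \<cdot> f = h \<cdot> (g \<cdot> f)"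
  by (simp add: hom_def Comp_assoc)

lemma id_hom: "f \<in> hom C X Y \<Longrightarrow> Id C X \<in> hom C X X" "f \<in> hom C X Y \<Longrightarrow> Id C Y \<in> hom C Y Y"
  by (auto simp: hom_def Id_Arr Dom_Id Cod_Id Dom_Obj Cod_Obj)

lemma comp_id: "f \<in> hom C X Y \<Longrightarrow> f \<cdot> Id C X = f" "f \<in> hom C X Y \<Longrightarrow> Id C Y \<cdot> f = f"
  by (auto simp: hom_def Comp_Id Id_Comp)

text \<open>Normalising with \<open>Comp_assoc\<close> nests composites to the right, which hides an
  instance of \<open>f \<cdot> p\<close> behind a further factor. Instantiated with a commuting
  square or triangle, this form rewrites inside the nested composite.\<close>

lemma comp_reassoc:
  "f \<cdot> p = k \<Longrightarrow> p \<in> hom C X Y \<Longrightarrow> f \<in> hom C Y Z \<Longrightarrow> z \<in> Arr C \<Longrightarrow> Cod C z = X \<Longrightarrow>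
    f \<cdot> (p \<cdot> z) = k \<cdot> z"
  by (auto simp: hom_def Comp_assoc)

lemmas cat_simps = hom_def Comp_Arr Dom_Comp Cod_Comp Comp_assoc

lemma commuting_squareI:
  assumes "p \<in> hom C P A" "q \<in> hom C P B" "f \<in> hom C A Z" "g \<in> hom C B Z" "f \<cdot> p = g \<cdot> q"
  shows "commuting_square C p q f g"
  using assms by (simp add: commuting_square_def hom_def)

lemma commuting_squareE:
  assumes "commuting_square C p q f g"
  obtains P A B Z where "p \<in> hom C P A" "q \<in> hom C P B" "f \<in> hom C A Z" "g \<in> hom C B Z"
    "f \<cdot> p = g \<cdot> q"
  using assms by (auto simp: commuting_square_def hom_def)

lemma commuting_square_sym: "commuting_square C p q f g \<Longrightarrow> commuting_square C q p g f"
  by (auto simp: commuting_square_def)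

lemma pullbackE:
  assumes "is_pullback C p q f g"
  obtains P A B Z where "p \<in> hom C P A" "q \<in> hom C P B" "f \<in> hom C A Z" "g \<in> hom C B Z"
    "f \<cdot> p = g \<cdot> q"
  using assms commuting_squareE[OF _ that] by (auto simp: is_pullback_def)

lemma pushoutE:
  assumes "is_pushout C p q f g"
  obtains P A B Z where "p \<in> hom C P A" "q \<in> hom C P B" "f \<in> hom C A Z" "g \<in> hom C B Z"
    "f \<cdot> p = g \<cdot> q"
  using assms commuting_squareE[OF _ that] by (auto simp: is_pushout_def)

section \<open>Universal properties as separate existence and uniqueness rules\<close>

lemma pullback_lift:
  assumes "is_pullback C p q f g" and "p \<in> hom C P A" "q \<in> hom C P B"
    and "p' \<in> hom C X A" "q' \<in> hom C X B" "f \<cdot> p' = g \<cdot> q'"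
  obtains u where "u \<in> hom C X P" "p \<cdot> u = p'" "q \<cdot> u = q'"
proof -
  have "commuting_square C p' q' f g"
    using assms by (auto simp: is_pullback_def commuting_square_def hom_def)
  then obtain u where "u \<in> hom C (Dom C p') (Dom C p)" "p \<cdot> u = p'" "q \<cdot> u = q'"
    using assms(1) unfolding is_pullback_def by metis
  with assms that show thesis by (simp add: hom_def)
qed

text \<open>The pair \<open>p \<cdot> u\<close>, \<open>q \<cdot> u\<close> is itself a cone over
  \<open>f\<close>, \<open>g\<close>, and both \<open>u\<close> and \<open>v\<close> mediate
  it.\<close>

lemma pullback_ext:
  assumes "is_pullback C p q f g" and "p \<in> hom C P A"
    and "u \<in> hom C X P" "v \<in> hom C X P" "p \<cdot> u = p \<cdot> v" "q \<cdot> u = q \<cdot> v"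
  shows "u = v"
proof -
  from assms(1) obtain P' A' B Z where h: "p \<in> hom C P' A'" "q \<in> hom C P' B" "f \<in> hom C A' Z"
    "g \<in> hom C B Z" "f \<cdot> p = g \<cdot> q" by (rule pullbackE)
  then have [simp]: "P' = P" "A' = A" using assms(2) by (auto simp: hom_def)
  have "f \<cdot> (p \<cdot> u) = g \<cdot> (q \<cdot> u)"
    using comp_assoc[OF assms(3) h(1)[simplified] h(3)[simplified]]
      comp_assoc[OF assms(3) h(2)[simplified] h(4)] h(5) by simp
  then have "commuting_square C (p \<cdot> u) (q \<cdot> u) f g"
    using commuting_squareI[OF comp_hom[OF assms(3) h(1)[simplified]]
        comp_hom[OF assms(3) h(2)[simplified]] h(3)[simplified] h(4)] by simp
  then have "\<exists>!w. w \<in> hom C (Dom C (p \<cdot> u)) (Dom C p) \<and> p \<cdot> w = p \<cdot> u \<and> q \<cdot> w = q \<cdot> u"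
    using assms(1) unfolding is_pullback_def by blast
  moreover have "Dom C (p \<cdot> u) = X" "Dom C p = P"
    using assms(2,3) by (auto simp: hom_def Dom_Comp)
  ultimately show "u = v" using assms(3-) by metis
qed

lemma pullbackI:
  assumes "p \<in> hom C P A" "q \<in> hom C P B" "f \<in> hom C A Z" "g \<in> hom C B Z" "f \<cdot> p = g \<cdot> q"
    and "\<And>X p' q'. p' \<in> hom C X A \<Longrightarrow> q' \<in> hom C X B \<Longrightarrow> f \<cdot> p' = g \<cdot> q' \<Longrightarrow>
      \<exists>u\<in>hom C X P. p \<cdot> u = p' \<and> q \<cdot> u = q'"
    and "\<And>X u v. u \<in> hom C X P \<Longrightarrow> v \<in> hom C X P \<Longrightarrow> p \<cdot> u = p \<cdot> v \<Longrightarrow> q \<cdot> u = q \<cdot> v \<Longrightarrow> u = v"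
  shows "is_pullback C p q f g"
  unfolding is_pullback_def
proof (intro conjI allI impI)
  show "commuting_square C p q f g" using assms(1-5) by (rule commuting_squareI)
next
  fix p' q' assume "commuting_square C p' q' f g"
  then have h: "p' \<in> hom C (Dom C p') A" "q' \<in> hom C (Dom C p') B" "f \<cdot> p' = g \<cdot> q'"
    using assms(1-4) by (auto simp: commuting_square_def hom_def)
  have "Dom C p = P" using assms(1) by (simp add: hom_def)
  then show "\<exists>!u. u \<in> hom C (Dom C p') (Dom C p) \<and> p \<cdot> u = p' \<and> q \<cdot> u = q'"
    using assms(6)[OF h] assms(7) by metis
qed

lemma pushout_desc:
  assumes "is_pushout C p q f g" and "f \<in> hom C A Z" "g \<in> hom C B Z"
    and "f' \<in> hom C A X" "g' \<in> hom C B X" "f' \<cdot> p = g' \<cdot> q"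
  obtains u where "u \<in> hom C Z X" "u \<cdot> f = f'" "u \<cdot> g = g'"
proof -
  have "commuting_square C p q f' g'"
    using assms by (auto simp: is_pushout_def commuting_square_def hom_def)
  then obtain u where "u \<in> hom C (Cod C f) (Cod C f')" "u \<cdot> f = f'" "u \<cdot> g = g'"
    using assms(1) unfolding is_pushout_def by metis
  with assms that show thesis by (simp add: hom_def)
qed

lemma pushout_ext:
  assumes "is_pushout C p q f g" and "f \<in> hom C A Z"
    and "u \<in> hom C Z X" "v \<in> hom C Z X" "u \<cdot> f = v \<cdot> f" "u \<cdot> g = v \<cdot> g"
  shows "u = v"
proof -
  from assms(1) obtain P A' B Z' where h: "p \<in> hom C P A'" "q \<in> hom C P B" "f \<in> hom C A' Z'"
    "g \<in> hom C B Z'" "f \<cdot> p = g \<cdot> q" by (rule pushoutE)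
  then have [simp]: "Z' = Z" "A' = A" using assms(2) by (auto simp: hom_def)
  have "(u \<cdot> f) \<cdot> p = (u \<cdot> g) \<cdot> q"
    using comp_assoc[OF h(1)[simplified] h(3)[simplified] assms(3)]
      comp_assoc[OF h(2)[simplified] h(4)[simplified] assms(3)] h(5) by simp
  then have "commuting_square C p q (u \<cdot> f) (u \<cdot> g)"
    using commuting_squareI[OF h(1)[simplified] h(2) comp_hom[OF h(3)[simplified] assms(3)]
        comp_hom[OF h(4)[simplified] assms(3)]] by simp
  then have "\<exists>!w. w \<in> hom C (Cod C f) (Cod C (u \<cdot> f)) \<and> w \<cdot> f = u \<cdot> f \<and> w \<cdot> g = u \<cdot> g"
    using assms(1) unfolding is_pushout_def by blast
  moreover have "Cod C (u \<cdot> f) = X" "Cod C f = Z"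
    using assms(2,3) by (auto simp: hom_def Cod_Comp)
  ultimately show "u = v" using assms(3-) by metis
qed

lemma pushoutI:
  assumes "p \<in> hom C P A" "q \<in> hom C P B" "f \<in> hom C A Z" "g \<in> hom C B Z" "f \<cdot> p = g \<cdot> q"
    and "\<And>X f' g'. f' \<in> hom C A X \<Longrightarrow> g' \<in> hom C B X \<Longrightarrow> f' \<cdot> p = g' \<cdot> q \<Longrightarrow>
      \<exists>u\<in>hom C Z X. u \<cdot> f = f' \<and> u \<cdot> g = g'"
    and "\<And>X u v. u \<in> hom C Z X \<Longrightarrow> v \<in> hom C Z X \<Longrightarrow> u \<cdot> f = v \<cdot> f \<Longrightarrow> u \<cdot> g = v \<cdot> g \<Longrightarrow> u = v"
  shows "is_pushout C p q f g"
  unfolding is_pushout_def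
proof (intro conjI allI impI)
  show "commuting_square C p q f g" using assms(1-5) by (rule commuting_squareI)
next
  fix f' g' assume "commuting_square C p q f' g'"
  then have h: "f' \<in> hom C A (Cod C f')" "g' \<in> hom C B (Cod C f')" "f' \<cdot> p = g' \<cdot> q"
    using assms(1-4) by (auto simp: commuting_square_def hom_def)
  have "Cod C f = Z" using assms(3) by (simp add: hom_def)
  then show "\<exists>!u. u \<in> hom C (Cod C f) (Cod C f') \<and> u \<cdot> f = f' \<and> u \<cdot> g = g'"
    using assms(6)[OF h] assms(7) by metis
qed

lemma is_pullback_sym:
  assumes pb: "is_pullback C p q f g"
  shows "is_pullback C q p g f"
proof -
  from pb obtain P A B Z where h: "p \<in> hom C P A" "q \<in> hom C P B" "f \<in> hom C A Z"
    "g \<in> hom C B Z" "f \<cdot> p = g \<cdot> q" by (rule pullbackE)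
  show ?thesis
  proof (rule pullbackI[OF h(2,1,4,3) h(5)[symmetric]])
    fix X q' p' assume "q' \<in> hom C X B" "p' \<in> hom C X A" "g \<cdot> q' = f \<cdot> p'"
    then show "\<exists>u\<in>hom C X P. q \<cdot> u = q' \<and> p \<cdot> u = p'"
      by (metis pullback_lift[OF pb h(1,2)])
  qed (use pullback_ext[OF pb h(1)] in blast)
qed

lemma is_pushout_sym:
  assumes po: "is_pushout C p q f g"
  shows "is_pushout C q p g f"
proof -
  from po obtain P A B Z where h: "p \<in> hom C P A" "q \<in> hom C P B" "f \<in> hom C A Z"
    "g \<in> hom C B Z" "f \<cdot> p = g \<cdot> q" by (rule pushoutE)
  show ?thesis
  proof (rule pushoutI[OF h(2,1,4,3) h(5)[symmetric]])
    fix X g' f' assume "g' \<in> hom C B X" "f' \<in> hom C A X" "g' \<cdot> q = f' \<cdot> p"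
    then show "\<exists>u\<in>hom C Z X. u \<cdot> g = g' \<and> u \<cdot> f = f'"
      by (metis pushout_desc[OF po h(3,4)])
  qed (use pushout_ext[OF po h(3)] in blast)
qed

section \<open>Monomorphisms and identity squares\<close>

lemma monoI:
  assumes "f \<in> hom C A B"
    and "\<And>X u v. u \<in> hom C X A \<Longrightarrow> v \<in> hom C X A \<Longrightarrow> f \<cdot> u = f \<cdot> v \<Longrightarrow> u = v"
  shows "monomorphism C f"
  using assms by (auto simp: monomorphism_def hom_def)

lemma mono_cancel:
  assumes "monomorphism C f" "f \<in> hom C A B" "u \<in> hom C X A" "v \<in> hom C X A" "f \<cdot> u = f \<cdot> v"
  shows "u = v"
  using assms by (simp add: monomorphism_def hom_def)

lemma mono_pullback:
  assumes pb: "is_pullback C p q f g" and "monomorphism C f"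
  shows "monomorphism C q"
proof -
  from pb obtain P A B Z where h: "p \<in> hom C P A" "q \<in> hom C P B" "f \<in> hom C A Z"
    "g \<in> hom C B Z" "f \<cdot> p = g \<cdot> q" by (rule pullbackE)
  show ?thesis
  proof (rule monoI[OF h(2)])
    fix X u v assume uv: "u \<in> hom C X P" "v \<in> hom C X P" "q \<cdot> u = q \<cdot> v"
    have "f \<cdot> (p \<cdot> u) = f \<cdot> (p \<cdot> v)"
      using comp_reassoc[OF h(5,1,3)] uv h by (simp add: cat_simps)
    then have "p \<cdot> u = p \<cdot> v"
      using mono_cancel[OF assms(2) h(3)] comp_hom h uv by blast
    then show "u = v" using pullback_ext[OF pb h(1)] uv by blast
  qed
qed

text \<open>Since \<open>n\<close> cancels on the left, the cones over \<open>n \<cdot> f\<close>,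
  \<open>n \<cdot> g\<close> are exactly the cones over \<open>f\<close>, \<open>g\<close>.\<close>

lemma pullback_mono_postcomp:
  assumes pb: "is_pullback C p q f g" and "monomorphism C n" "n \<in> hom C Z W" "f \<in> hom C A Z"
  shows "is_pullback C p q (n \<cdot> f) (n \<cdot> g)"
proof -
  from pb assms(4) obtain P B where h: "p \<in> hom C P A" "q \<in> hom C P B"
    "g \<in> hom C B Z" "f \<cdot> p = g \<cdot> q" by (elim pullbackE) (auto simp: hom_def)
  show ?thesis
  proof (rule pullbackI[OF h(1,2) comp_hom[OF assms(4,3)] comp_hom[OF h(3) assms(3)]])
    show "(n \<cdot> f) \<cdot> p = (n \<cdot> g) \<cdot> q" using h assms by (simp add: cat_simps)
  next
    fix X p' q' assume a: "p' \<in> hom C X A" "q' \<in> hom C X B" "(n \<cdot> f) \<cdot> p' = (n \<cdot> g) \<cdot> q'"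
    then have "n \<cdot> (f \<cdot> p') = n \<cdot> (g \<cdot> q')"
      using h assms
      by (simp add: cat_simps)
    then have "f \<cdot> p' = g \<cdot> q'"
      using mono_cancel[OF assms(2,3)] comp_hom h assms a by blast
    then show "\<exists>u\<in>hom C X P. p \<cdot> u = p' \<and> q \<cdot> u = q'"
      using pullback_lift[OF pb h(1,2) a(1,2)] by blast
  next
    fix X u v assume "u \<in> hom C X P" "v \<in> hom C X P" "p \<cdot> u = p \<cdot> v" "q \<cdot> u = q \<cdot> v"
    then show "u = v" using pullback_ext[OF pb h(1)] by blast
  qed
qed

lemma pullback_id:
  assumes f: "f \<in> hom C A B"
  shows "is_pullback C f (Id C A) (Id C B) f"
proof (rule pullbackI[OF f id_hom(1)[OF f] id_hom(2)[OF f] f])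
  show "Id C B \<cdot> f = f \<cdot> Id C A" using f by (simp add: comp_id)
next
  fix X p' q' assume a: "p' \<in> hom C X B" "q' \<in> hom C X A" "Id C B \<cdot> p' = f \<cdot> q'"
  then show "\<exists>u\<in>hom C X A. f \<cdot> u = p' \<and> Id C A \<cdot> u = q'"
    using a comp_id(2)[OF a(1)] comp_id(2)[OF a(2)] by auto
next
  fix X u v assume a: "u \<in> hom C X A" "v \<in> hom C X A" "Id C A \<cdot> u = Id C A \<cdot> v"
  then show "u = v" using comp_id(2)[OF a(1)] comp_id(2)[OF a(2)] by simp
qed

lemma pushout_id:
  assumes f: "f \<in> hom C A B"
  shows "is_pushout C (Id C A) f f (Id C B)"
proof (rule pushoutI[OF id_hom(1)[OF f] f f id_hom(2)[OF f]])
  show "f \<cdot> Id C A = Id C B \<cdot> f" using f by (simp add: comp_id)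
next
  fix X f' g' assume a: "f' \<in> hom C A X" "g' \<in> hom C B X" "f' \<cdot> Id C A = g' \<cdot> f"
  then show "\<exists>u\<in>hom C B X. u \<cdot> f = f' \<and> u \<cdot> Id C B = g'"
    using a comp_id(1)[OF a(1)] comp_id(1)[OF a(2)] by auto
next
  fix X u v assume a: "u \<in> hom C B X" "v \<in> hom C B X" "u \<cdot> Id C B = v \<cdot> Id C B"
  then show "u = v" using comp_id(1)[OF a(1)] comp_id(1)[OF a(2)] by simp
qed

text \<open>This is the trivial pullback of \<open>f\<close> along an identity, postcomposed with
  \<open>n\<close>. It supplies those faces of van Kampen cubes in which a vertical arrow is an
  identity.\<close>

lemma pullback_mono_id:
  assumes "monomorphism C n" and n: "n \<in> hom C Z W" and f: "f \<in> hom C A Z"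
  shows "is_pullback C f (Id C A) n (n \<cdot> f)"
  using pullback_mono_postcomp[OF pullback_id[OF f] assms(1) n id_hom(2)[OF f]] comp_id(1)[OF n]
  by simp

section \<open>Pasting and cancellation of squares\<close>

lemma pullback_paste:
  assumes r: "is_pullback C p q f g" and l: "is_pullback C u w q k"
  shows "is_pullback C (p \<cdot> u) w f (g \<cdot> k)"
proof -
  from r obtain P A B Z where h: "p \<in> hom C P A" "q \<in> hom C P B" "f \<in> hom C A Z"
    "g \<in> hom C B Z" "f \<cdot> p = g \<cdot> q" by (rule pullbackE)
  with l obtain Q Y where i: "u \<in> hom C Q P" "w \<in> hom C Q Y" "k \<in> hom C Y B" "q \<cdot> u = k \<cdot> w"
    by (elim pullbackE) (auto simp: hom_def)
  show ?thesis
  proof (rule pullbackI[OF comp_hom[OF i(1) h(1)] i(2) h(3) comp_hom[OF i(3) h(4)]])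
    show "f \<cdot> (p \<cdot> u) = (g \<cdot> k) \<cdot> w"
      using h i comp_reassoc[OF h(5,1,3)] comp_reassoc[OF i(4,1) h(2)]
      by (simp add: cat_simps)
  next
    fix X p' q' assume a: "p' \<in> hom C X A" "q' \<in> hom C X Y" "f \<cdot> p' = (g \<cdot> k) \<cdot> q'"
    then have "f \<cdot> p' = g \<cdot> (k \<cdot> q')"
      using h i comp_reassoc[OF h(5,1,3)] comp_reassoc[OF i(4,1) h(2)]
      by (simp add: cat_simps)
    then obtain s where s: "s \<in> hom C X P" "p \<cdot> s = p'" "q \<cdot> s = k \<cdot> q'"
      using pullback_lift[OF r h(1,2) a(1) comp_hom[OF a(2) i(3)]] by blast
    then obtain t where t: "t \<in> hom C X Q" "u \<cdot> t = s" "w \<cdot> t = q'"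
      using pullback_lift[OF l i(1,2) s(1) a(2)] by blast
    then have "(p \<cdot> u) \<cdot> t = p'"
      using s h i comp_reassoc[OF h(5,1,3)] comp_reassoc[OF i(4,1) h(2)]
      by (simp add: cat_simps)
    then show "\<exists>u'\<in>hom C X Q. (p \<cdot> u) \<cdot> u' = p' \<and> w \<cdot> u' = q'"
      using t by blast
  next
    fix X s t assume a: "s \<in> hom C X Q" "t \<in> hom C X Q" "(p \<cdot> u) \<cdot> s = (p \<cdot> u) \<cdot> t" "w \<cdot> s = w \<cdot> t"
    have "p \<cdot> (u \<cdot> s) = p \<cdot> (u \<cdot> t)" "q \<cdot> (u \<cdot> s) = q \<cdot> (u \<cdot> t)"
      using a h i comp_reassoc[OF h(5,1,3)] comp_reassoc[OF i(4,1) h(2)] by (simp_all add: cat_simps)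
    then have "u \<cdot> s = u \<cdot> t"
      using pullback_ext[OF r h(1)] comp_hom a i by blast
    then show "s = t" using pullback_ext[OF l i(1)] a by blast
  qed
qed

text \<open>A cone over \<open>q\<close>, \<open>k\<close> extends by \<open>p\<close> to a cone
  over the outer square and lifts there. That the lift has the right composite with \<open>u\<close>
  is checked after \<open>p\<close> and after \<open>q\<close>, which are jointly monic.\<close>

lemma pullback_cancel:
  assumes r: "is_pullback C p q f g" and o: "is_pullback C (p \<cdot> u) w f (g \<cdot> k)"
    and l: "commuting_square C u w q k"
  shows "is_pullback C u w q k"
proof -
  from r obtain P A B Z where h: "p \<in> hom C P A" "q \<in> hom C P B" "f \<in> hom C A Z"
    "g \<in> hom C B Z" "f \<cdot> p = g \<cdot> q" by (rule pullbackE)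
  with l obtain Q Y where i: "u \<in> hom C Q P" "w \<in> hom C Q Y" "k \<in> hom C Y B" "q \<cdot> u = k \<cdot> w"
    by (elim commuting_squareE) (auto simp: hom_def)
  show ?thesis
  proof (rule pullbackI[OF i(1,2) h(2) i(3,4)])
    fix X p' q' assume a: "p' \<in> hom C X P" "q' \<in> hom C X Y" "q \<cdot> p' = k \<cdot> q'"
    have "f \<cdot> (p \<cdot> p') = (g \<cdot> k) \<cdot> q'"
      using a h i comp_reassoc[OF h(5,1,3)] comp_reassoc[OF i(4,1) h(2)]
      by (simp add: cat_simps)
    then obtain t where t: "t \<in> hom C X Q" "(p \<cdot> u) \<cdot> t = p \<cdot> p'" "w \<cdot> t = q'"
      using pullback_lift[OF o comp_hom[OF i(1) h(1)] i(2) comp_hom[OF a(1) h(1)] a(2)] by blast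
    have "p \<cdot> (u \<cdot> t) = p \<cdot> p'" "q \<cdot> (u \<cdot> t) = q \<cdot> p'"
      using t a h i comp_reassoc[OF h(5,1,3)] comp_reassoc[OF i(4,1) h(2)]
      by (simp_all add: cat_simps)
    then have "u \<cdot> t = p'"
      using pullback_ext[OF r h(1)] comp_hom a i t by blast
    then show "\<exists>u'\<in>hom C X Q. u \<cdot> u' = p' \<and> w \<cdot> u' = q'"
      using t by blast
  next
    fix X s t assume a: "s \<in> hom C X Q" "t \<in> hom C X Q" "u \<cdot> s = u \<cdot> t" "w \<cdot> s = w \<cdot> t"
    have "(p \<cdot> u) \<cdot> s = (p \<cdot> u) \<cdot> t"
      using a h i comp_reassoc[OF h(5,1,3)] comp_reassoc[OF i(4,1) h(2)] by (simp add: cat_simps)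
    then show "s = t" using pullback_ext[OF o comp_hom[OF i(1) h(1)]] a by blast
  qed
qed

lemma pushout_paste:
  assumes l: "is_pushout C p q f g" and r: "is_pushout C g u k w"
  shows "is_pushout C p (u \<cdot> q) (k \<cdot> f) w"
proof -
  from l obtain P A B Z where h: "p \<in> hom C P A" "q \<in> hom C P B" "f \<in> hom C A Z"
    "g \<in> hom C B Z" "f \<cdot> p = g \<cdot> q" by (rule pushoutE)
  with r obtain Q Y where i: "u \<in> hom C B Q" "k \<in> hom C Z Y" "w \<in> hom C Q Y" "k \<cdot> g = w \<cdot> u"
    by (elim pushoutE) (auto simp: hom_def)
  show ?thesis
  proof (rule pushoutI[OF h(1) comp_hom[OF h(2) i(1)] comp_hom[OF h(3) i(2)] i(3)])
    show "(k \<cdot> f) \<cdot> p = w \<cdot> (u \<cdot> q)"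
      using h i comp_reassoc[OF h(5,1,3)] comp_reassoc[OF i(4) h(4) i(2)]
      by (simp add: cat_simps)
  next
    fix X f' g' assume a: "f' \<in> hom C A X" "g' \<in> hom C Q X" "f' \<cdot> p = g' \<cdot> (u \<cdot> q)"
    then have "f' \<cdot> p = (g' \<cdot> u) \<cdot> q"
      using h i comp_reassoc[OF h(5,1,3)] comp_reassoc[OF i(4) h(4) i(2)]
      by (simp add: cat_simps)
    then obtain s where s: "s \<in> hom C Z X" "s \<cdot> f = f'" "s \<cdot> g = g' \<cdot> u"
      using pushout_desc[OF l h(3,4) a(1) comp_hom[OF i(1) a(2)]] by blast
    then obtain t where t: "t \<in> hom C Y X" "t \<cdot> k = s" "t \<cdot> w = g'"
      using pushout_desc[OF r i(2,3) s(1) a(2)] by blast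
    then have "t \<cdot> (k \<cdot> f) = f'"
      using s h i comp_reassoc[OF t(2) i(2) t(1)]
      by (simp add: cat_simps)
    then show "\<exists>t\<in>hom C Y X. t \<cdot> (k \<cdot> f) = f' \<and> t \<cdot> w = g'"
      using t by blast
  next
    fix X s t assume a: "s \<in> hom C Y X" "t \<in> hom C Y X" "s \<cdot> (k \<cdot> f) = t \<cdot> (k \<cdot> f)" "s \<cdot> w = t \<cdot> w"
    have "(s \<cdot> k) \<cdot> f = (t \<cdot> k) \<cdot> f" "(s \<cdot> k) \<cdot> g = (t \<cdot> k) \<cdot> g"
      using a h i comp_reassoc[OF h(5,1,3)] comp_reassoc[OF i(4) h(4) i(2)]
        comp_reassoc[OF a(4) i(3) a(1)]
      by (simp_all add: cat_simps)
    then have "s \<cdot> k = t \<cdot> k"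
      using pushout_ext[OF l h(3)] comp_hom a i by blast
    then show "s = t" using pushout_ext[OF r i(2)] a by blast
  qed
qed

text \<open>Dual to cancellation of pullbacks: the arrow comes from the outer pushout, and its
  composite with \<open>k\<close> is determined because \<open>f\<close> and \<open>g\<close> are
  jointly epic.\<close>

lemma pushout_cancel:
  assumes l: "is_pushout C p q f g" and o: "is_pushout C p (u \<cdot> q) (k \<cdot> f) w"
    and r: "commuting_square C g u k w"
  shows "is_pushout C g u k w"
proof -
  from l obtain P A B Z where h: "p \<in> hom C P A" "q \<in> hom C P B" "f \<in> hom C A Z"
    "g \<in> hom C B Z" "f \<cdot> p = g \<cdot> q" by (rule pushoutE)
  with r obtain Q Y where i: "u \<in> hom C B Q" "k \<in> hom C Z Y" "w \<in> hom C Q Y" "k \<cdot> g = w \<cdot> u"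
    by (elim commuting_squareE) (auto simp: hom_def)
  show ?thesis
  proof (rule pushoutI[OF h(4) i])
    fix X f' g' assume a: "f' \<in> hom C Z X" "g' \<in> hom C Q X" "f' \<cdot> g = g' \<cdot> u"
    have "(f' \<cdot> f) \<cdot> p = g' \<cdot> (u \<cdot> q)"
      using a h i comp_reassoc[OF h(5,1,3)] comp_reassoc[OF i(4) h(4) i(2)]
        comp_reassoc[OF a(3) h(4) a(1)]
      by (simp add: cat_simps)
    then obtain t where t: "t \<in> hom C Y X" "t \<cdot> (k \<cdot> f) = f' \<cdot> f" "t \<cdot> w = g'"
      using pushout_desc[OF o comp_hom[OF h(3) i(2)] i(3) comp_hom[OF h(3) a(1)] a(2)] by blast
    have "(t \<cdot> k) \<cdot> f = f' \<cdot> f" "(t \<cdot> k) \<cdot> g = f' \<cdot> g"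
      using t a h i comp_reassoc[OF h(5,1,3)] comp_reassoc[OF i(4) h(4) i(2)]
        comp_reassoc[OF t(3) i(3) t(1)]
      by (simp_all add: cat_simps)
    then have "t \<cdot> k = f'"
      using pushout_ext[OF l h(3)] comp_hom a i t by blast
    then show "\<exists>t\<in>hom C Y X. t \<cdot> k = f' \<and> t \<cdot> w = g'"
      using t by blast
  next
    fix X s t assume a: "s \<in> hom C Y X" "t \<in> hom C Y X" "s \<cdot> k = t \<cdot> k" "s \<cdot> w = t \<cdot> w"
    have "s \<cdot> (k \<cdot> f) = t \<cdot> (k \<cdot> f)"
      using a h i comp_reassoc[OF a(3) i(2) a(1)] by (simp add: cat_simps)
    then show "s = t" using pushout_ext[OF o comp_hom[OF h(3) i(2)]] a by blast
  qed
qed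

lemma pushout_desc_unique:
  assumes "is_pushout C p q f g" "commuting_square C p q f' g'"
  obtains k where
    "is_the_unique (\<lambda>k. k \<in> hom C (Cod C f) (Cod C f') \<and> k \<cdot> f = f' \<and> k \<cdot> g = g') k"
  using assms unfolding is_pushout_def is_the_unique_def by metis

text \<open>The outer square is also a cocone with second leg \<open>g' \<cdot> u\<close>, so the
  smaller pushout yields \<open>k\<close>; cancellation then makes the remaining square a pushout.
  This is what splits a rewriting step through the overlap.\<close>

lemma pushout_factor:
  assumes po: "is_pushout C p q f g" and po': "is_pushout C p (u \<cdot> q) f' g'"
    and u: "u \<in> hom C (Cod C q) U"
  obtains k where
    "is_the_unique (\<lambda>k. k \<in> hom C (Cod C f) (Cod C f') \<and> k \<cdot> f = f' \<and> k \<cdot> g = g' \<cdot> u) k"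
    "is_pushout C g u k g'"
proof -
  from po obtain P A B Z where h: "p \<in> hom C P A" "q \<in> hom C P B" "f \<in> hom C A Z"
    "g \<in> hom C B Z" "f \<cdot> p = g \<cdot> q" by (rule pushoutE)
  with u have u: "u \<in> hom C B U" by (simp add: hom_def)
  from po' h comp_hom[OF h(2) u] obtain W where i: "f' \<in> hom C A W" "g' \<in> hom C U W"
    "f' \<cdot> p = g' \<cdot> (u \<cdot> q)"
    by (elim pushoutE) (auto simp: hom_def)
  have "f' \<cdot> p = (g' \<cdot> u) \<cdot> q"
    using i(3) comp_assoc[OF h(2) u i(2)] by simp
  then obtain k where
    k: "is_the_unique (\<lambda>k. k \<in> hom C (Cod C f) (Cod C f') \<and> k \<cdot> f = f' \<and> k \<cdot> g = g' \<cdot> u) k"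
    using pushout_desc_unique[OF po commuting_squareI[OF h(1,2) i(1) comp_hom[OF u i(2)]]] by blast
  then have k': "k \<in> hom C Z W" "k \<cdot> f = f'" "k \<cdot> g = g' \<cdot> u"
    using h i by (auto simp: is_the_unique_def hom_def)
  have "is_pushout C g u k g'"
    using pushout_cancel[OF po, of u k g'] po' k' commuting_squareI[OF h(4) u k'(1) i(2) k'(3)] by simp
  with k that show thesis by blast
qed

subsection \<open>Final pullback complements\<close>

lemma final_pbc_pullback: "final_pbc C b c a d \<Longrightarrow> is_pullback C b a c d"
  by (simp add: final_pbc_def)

text \<open>Existence half of finality. Writing the competing arrow directly as
  \<open>b \<cdot> e\<close> absorbs the equation \<open>b \<cdot> e = b'\<close> of the
  definition.\<close>

lemma final_pbc_lift:
  assumes f: "final_pbc C b c a d" and h: "b \<in> hom C A B" "d \<in> hom C D X"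
    and pb: "is_pullback C (b \<cdot> e) a' c d'" and h': "e \<in> hom C A' A" "d' \<in> hom C D' X"
  obtains g where "g \<in> hom C D' D" "g \<cdot> a' = a \<cdot> e" "d \<cdot> g = d'"
proof -
  have "e \<in> hom C (Dom C (b \<cdot> e)) (Dom C b)"
    using h h' by (simp add: cat_simps)
  with f pb obtain g where "g \<in> hom C (Dom C d') (Dom C d)" "g \<cdot> a' = a \<cdot> e" "d \<cdot> g = d'"
    unfolding final_pbc_def by blast
  with that h h' show thesis by (simp add: hom_def)
qed

lemma final_pbc_ext:
  assumes f: "final_pbc C b c a d" and h: "b \<in> hom C A B" "d \<in> hom C D X"
    and pb: "is_pullback C (b \<cdot> e) a' c (d \<cdot> g)" and h': "e \<in> hom C A' A"
    and gh: "g \<in> hom C D' D" "h \<in> hom C D' D" "g \<cdot> a' = a \<cdot> e" "h \<cdot> a' = a \<cdot> e" "d \<cdot> g = d \<cdot> h"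
  shows "g = h"
proof -
  have "e \<in> hom C (Dom C (b \<cdot> e)) (Dom C b)"
    using h h' by (simp add: cat_simps)
  with f pb have "\<exists>!k. k \<in> hom C (Dom C (d \<cdot> g)) (Dom C d) \<and> k \<cdot> a' = a \<cdot> e \<and> d \<cdot> k = d \<cdot> g"
    unfolding final_pbc_def by blast
  moreover have "Dom C (d \<cdot> g) = D'" "Dom C d = D"
    using h gh by (auto simp: cat_simps)
  ultimately show "g = h" using gh by metis
qed

lemma final_pbcI:
  assumes pb: "is_pullback C b a c d" and h: "b \<in> hom C A B" "d \<in> hom C D X"
    and lift: "\<And>A' D' a' d' e. is_pullback C (b \<cdot> e) a' c d' \<Longrightarrow> e \<in> hom C A' A \<Longrightarrow>
      a' \<in> hom C A' D' \<Longrightarrow> d' \<in> hom C D' X \<Longrightarrow> \<exists>g\<in>hom C D' D. g \<cdot> a' = a \<cdot> e \<and> d \<cdot> g = d'"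
    and ext: "\<And>A' D' a' e g h. is_pullback C (b \<cdot> e) a' c (d \<cdot> g) \<Longrightarrow> e \<in> hom C A' A \<Longrightarrow>
      a' \<in> hom C A' D' \<Longrightarrow> g \<in> hom C D' D \<Longrightarrow> h \<in> hom C D' D \<Longrightarrow>
      g \<cdot> a' = a \<cdot> e \<Longrightarrow> h \<cdot> a' = a \<cdot> e \<Longrightarrow> d \<cdot> g = d \<cdot> h \<Longrightarrow> g = h"
  shows "final_pbc C b c a d"
  unfolding final_pbc_def
proof (intro conjI allI impI pb, elim conjE)
  fix b' a' d' e
  assume a: "is_pullback C b' a' c d'" and e: "e \<in> hom C (Dom C b') (Dom C b)" and b': "b \<cdot> e = b'"
  have X: "Cod C c = X" using pb h by (elim pullbackE) (auto simp: hom_def)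
  from a have h': "a' \<in> hom C (Dom C b') (Dom C d')" "d' \<in> hom C (Dom C d') X"
    using X by (auto elim!: pullbackE simp: hom_def)
  have [simp]: "Dom C b = A" "Dom C d = D" using h by (auto simp: hom_def)
  from lift[of e a' d', OF _ _ h'] a e b'
  obtain g where g: "g \<in> hom C (Dom C d') D" "g \<cdot> a' = a \<cdot> e" "d \<cdot> g = d'" by auto
  show "\<exists>!g. g \<in> hom C (Dom C d') (Dom C d) \<and> g \<cdot> a' = a \<cdot> e \<and> d \<cdot> g = d'"
  proof (rule ex1I[of _ g])
    fix k assume k: "k \<in> hom C (Dom C d') (Dom C d) \<and> k \<cdot> a' = a \<cdot> e \<and> d \<cdot> k = d'"
    show "k = g"
      by (rule ext[of e a' k]) (use a e b' g k h' in auto)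
  qed (use g in simp)
qed

text \<open>A competitor for the composite is a competitor for \<open>f1\<close> and gives an arrow
  \<open>g\<close> into the middle object. Cancelling the pullback of \<open>f1\<close> shows that
  the square over \<open>a\<close> and \<open>g\<close> is a pullback, hence a competitor for
  \<open>f2\<close>. Uniqueness follows the same two stages.\<close>

lemma final_pbc_compose:
  assumes f1: "final_pbc C b1 c a d1" and f2: "final_pbc C b2 a a2 d2"
  shows "final_pbc C (b1 \<cdot> b2) c a2 (d1 \<cdot> d2)"
proof -
  note pb1 = final_pbc_pullback[OF f1] and pb2 = final_pbc_pullback[OF f2]
  from pb1 obtain A B D X where h: "b1 \<in> hom C A B" "a \<in> hom C A D" "c \<in> hom C B X"
    "d1 \<in> hom C D X" "c \<cdot> b1 = d1 \<cdot> a" by (rule pullbackE)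
  with pb2 obtain A2 D2 where i: "b2 \<in> hom C A2 A" "a2 \<in> hom C A2 D2" "d2 \<in> hom C D2 D"
    "a \<cdot> b2 = d2 \<cdot> a2" by (elim pullbackE) (auto simp: hom_def)
  show ?thesis
  proof (rule final_pbcI[OF pullback_paste[OF pb1 pb2] comp_hom[OF i(1) h(1)] comp_hom[OF i(3) h(4)]])
    fix A' D' a' d' e
    assume pb: "is_pullback C ((b1 \<cdot> b2) \<cdot> e) a' c d'"
      and e: "e \<in> hom C A' A2" "a' \<in> hom C A' D'" "d' \<in> hom C D' X"
    have pb': "is_pullback C (b1 \<cdot> (b2 \<cdot> e)) a' c d'"
      using pb comp_assoc[OF e(1) i(1) h(1)] by simp
    then obtain g where g: "g \<in> hom C D' D" "g \<cdot> a' = a \<cdot> (b2 \<cdot> e)" "d1 \<cdot> g = d'"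
      by (rule final_pbc_lift[OF f1 h(1,4) _ comp_hom[OF e(1) i(1)] e(3)])
    have "is_pullback C (b2 \<cdot> e) a' a g"
      using pullback_cancel[OF pb1, of "b2 \<cdot> e" a' g] pb' g
        commuting_squareI[OF comp_hom[OF e(1) i(1)] e(2) h(2) g(1)] by simp
    then obtain g' where g': "g' \<in> hom C D' D2" "g' \<cdot> a' = a2 \<cdot> e" "d2 \<cdot> g' = g"
      by (rule final_pbc_lift[OF f2 i(1,3) _ e(1) g(1)])
    then show "\<exists>g\<in>hom C D' D2. g \<cdot> a' = a2 \<cdot> e \<and> (d1 \<cdot> d2) \<cdot> g = d'"
      using comp_assoc[OF g'(1) i(3) h(4)] g by auto
  next
    fix A' D' a' e g k
    assume pb: "is_pullback C ((b1 \<cdot> b2) \<cdot> e) a' c ((d1 \<cdot> d2) \<cdot> g)"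
      and e: "e \<in> hom C A' A2" "a' \<in> hom C A' D'"
      and g: "g \<in> hom C D' D2" "k \<in> hom C D' D2" "g \<cdot> a' = a2 \<cdot> e" "k \<cdot> a' = a2 \<cdot> e"
        "(d1 \<cdot> d2) \<cdot> g = (d1 \<cdot> d2) \<cdot> k"
    have pb': "is_pullback C (b1 \<cdot> (b2 \<cdot> e)) a' c (d1 \<cdot> (d2 \<cdot> g))"
      using pb comp_assoc[OF e(1) i(1) h(1)] comp_assoc[OF g(1) i(3) h(4)] by simp
    have g': "(d2 \<cdot> g) \<cdot> a' = a \<cdot> (b2 \<cdot> e)" "(d2 \<cdot> k) \<cdot> a' = a \<cdot> (b2 \<cdot> e)"
      using e g i h(2) comp_reassoc[OF i(4,1) h(2)] by (simp_all add: cat_simps)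
    have "d1 \<cdot> (d2 \<cdot> g) = d1 \<cdot> (d2 \<cdot> k)"
      using comp_assoc[OF g(1) i(3) h(4)] comp_assoc[OF g(2) i(3) h(4)] g(5) by simp
    with g' have eq: "d2 \<cdot> g = d2 \<cdot> k"
      using final_pbc_ext[OF f1 h(1,4) pb' comp_hom[OF e(1) i(1)]] comp_hom[OF _ i(3)] g by blast
    have "is_pullback C (b2 \<cdot> e) a' a (d2 \<cdot> g)"
      using pullback_cancel[OF pb1, of "b2 \<cdot> e" a' "d2 \<cdot> g"] pb' g'
        commuting_squareI[OF comp_hom[OF e(1) i(1)] e(2) h(2) comp_hom[OF g(1) i(3)]] by simp
    then show "g = k"
      using final_pbc_ext[OF f2 i(1,3) _ e(1) g(1-4) eq] by simp
  qed
qed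

text \<open>Final pullback complements are stable under base change along \<open>v\<close>. A
  competitor over \<open>c'\<close> pasted with \<open>l\<close> competes for \<open>f\<close>; the
  resulting arrow into \<open>D\<close>, paired with \<open>d0\<close>, lifts through the pullback
  \<open>r\<close> to \<open>D'\<close>. The equations are checked after \<open>w\<close> and
  \<open>d'\<close>, which are jointly monic.\<close>

lemma final_pbc_stable:
  assumes f: "final_pbc C b c a d"
    and l: "is_pullback C v' c' c v" and r: "is_pullback C w d' d v" and t: "is_pullback C u b' b v'"
    and sq: "commuting_square C b' a' c' d'" and eq: "w \<cdot> a' = a \<cdot> u"
  shows "final_pbc C b' c' a' d'"
proof -
  note pb = final_pbc_pullback[OF f]
  from pb obtain A B D X where h: "b \<in> hom C A B" "a \<in> hom C A D" "c \<in> hom C B X"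
    "d \<in> hom C D X" "c \<cdot> b = d \<cdot> a" by (rule pullbackE)
  with l obtain B' Y where i: "v' \<in> hom C B' B" "c' \<in> hom C B' Y" "v \<in> hom C Y X"
    "c \<cdot> v' = v \<cdot> c'" by (elim pullbackE) (auto simp: hom_def)
  with r h obtain D' where j: "w \<in> hom C D' D" "d' \<in> hom C D' Y" "d \<cdot> w = v \<cdot> d'"
    by (elim pullbackE) (auto simp: hom_def)
  from t h i obtain A' where k: "u \<in> hom C A' A" "b' \<in> hom C A' B'" "b \<cdot> u = v' \<cdot> b'"
    by (elim pullbackE) (auto simp: hom_def)
  with sq i j have a': "a' \<in> hom C A' D'" "c' \<cdot> b' = d' \<cdot> a'"
    by (auto elim!: commuting_squareE simp: hom_def)
  \<comment> \<open>Pasting \<open>pb\<close> with \<open>t\<close> gives a pullback with legs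
    \<open>a \<cdot> u\<close> and \<open>c \<cdot> v'\<close>. Two faces of the cube let these be
    read as \<open>w \<cdot> a'\<close> and \<open>v \<cdot> c'\<close>, the form in which
    \<open>r\<close> can be cancelled.\<close>
  have "is_pullback C (w \<cdot> a') b' d (v \<cdot> c')"
    using pullback_paste[OF is_pullback_sym[OF pb] t] eq i(4) by simp
  then have pb': "is_pullback C b' a' c' d'"
    using pullback_cancel[OF r _ commuting_square_sym[OF sq]] is_pullback_sym by blast
  have outer: "is_pullback C (b \<cdot> (u \<cdot> e)) a0 c (v \<cdot> d0)"
    if "is_pullback C (b' \<cdot> e) a0 c' d0" "e \<in> hom C E A'" for e E a0 d0
  proof -
    have "v' \<cdot> (b' \<cdot> e) = b \<cdot> (u \<cdot> e)"
      using that h i k comp_reassoc[OF k(3,1) h(1)] by (simp add: cat_simps)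
    with pullback_paste[OF l that(1)] show ?thesis by simp
  qed
  show ?thesis
  proof (rule final_pbcI[OF pb' k(2) j(2)])
    fix E D0 a0 d0 e
    assume p: "is_pullback C (b' \<cdot> e) a0 c' d0"
      and e: "e \<in> hom C E A'" "a0 \<in> hom C E D0" "d0 \<in> hom C D0 Y"
    from outer[OF p e(1)] obtain g where g: "g \<in> hom C D0 D" "g \<cdot> a0 = a \<cdot> (u \<cdot> e)" "d \<cdot> g = v \<cdot> d0"
      by (rule final_pbc_lift[OF f h(1,4) _ comp_hom[OF e(1) k(1)] comp_hom[OF e(3) i(3)]])
    obtain g' where g': "g' \<in> hom C D0 D'" "w \<cdot> g' = g" "d' \<cdot> g' = d0"
      by (rule pullback_lift[OF r j(1,2) g(1) e(3) g(3)])
    have "c' \<cdot> (b' \<cdot> e) = d0 \<cdot> a0"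
      using p by (rule pullbackE)
    then have "d' \<cdot> (g' \<cdot> a0) = d' \<cdot> (a' \<cdot> e)"
      using e g' a' j i k comp_reassoc[OF g'(3,1) j(2)] comp_reassoc[OF a'(2) k(2) i(2)]
      by (simp add: cat_simps)
    moreover have "w \<cdot> (g' \<cdot> a0) = w \<cdot> (a' \<cdot> e)"
      using e g g' a' h j i k comp_reassoc[OF g'(2,1) j(1)] comp_reassoc[OF eq a'(1) j(1)]
      by (simp add: cat_simps)
    ultimately have "g' \<cdot> a0 = a' \<cdot> e"
      using pullback_ext[OF r j(1) comp_hom[OF e(2) g'(1)] comp_hom[OF e(1) a'(1)]] by blast
    with g' show "\<exists>g\<in>hom C D0 D'. g \<cdot> a0 = a' \<cdot> e \<and> d' \<cdot> g = d0" by blast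
  next
    fix E D0 a0 e g1 g2
    assume p: "is_pullback C (b' \<cdot> e) a0 c' (d' \<cdot> g1)"
      and e: "e \<in> hom C E A'" "a0 \<in> hom C E D0"
      and g: "g1 \<in> hom C D0 D'" "g2 \<in> hom C D0 D'" "g1 \<cdot> a0 = a' \<cdot> e" "g2 \<cdot> a0 = a' \<cdot> e"
        "d' \<cdot> g1 = d' \<cdot> g2"
    have dw: "d \<cdot> (w \<cdot> g1) = v \<cdot> (d' \<cdot> g1)" "d \<cdot> (w \<cdot> g2) = v \<cdot> (d' \<cdot> g2)"
      using g i j h comp_reassoc[OF j(3,1) h(4)] by (simp_all add: cat_simps)
    have wa: "(w \<cdot> g1) \<cdot> a0 = a \<cdot> (u \<cdot> e)" "(w \<cdot> g2) \<cdot> a0 = a \<cdot> (u \<cdot> e)"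
      using e g a' j h k comp_reassoc[OF eq a'(1) j(1)] by (simp_all add: cat_simps)
    have "is_pullback C (b \<cdot> (u \<cdot> e)) a0 c (d \<cdot> (w \<cdot> g1))"
      using outer[OF p e(1)] dw by simp
    then have "w \<cdot> g1 = w \<cdot> g2"
      using final_pbc_ext[OF f h(1,4) _ comp_hom[OF e(1) k(1)] comp_hom[OF g(1) j(1)]
          comp_hom[OF g(2) j(1)] wa] dw g(5) by simp
    then show "g1 = g2"
      using pullback_ext[OF r j(1) g(1,2)] g(5) by blast
  qed
qed

end

section \<open>Final pullback complements along a composite with a monomorphism\<close>

context adhesive_category
begin

text \<open>For a cone \<open>x\<close>, \<open>y\<close> on \<open>n\<close> and \<open>d\<close>,
  the pullback of \<open>c\<close> along \<open>x\<close> competes for \<open>f'\<close> and yields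
  \<open>g\<close> with \<open>d' \<cdot> g = x\<close>. Because \<open>n\<close> is mono, the same
  span is also a pullback over \<open>n \<cdot> c\<close>, so it competes for \<open>f\<close>,
  whose uniqueness clause forces \<open>u \<cdot> g = y\<close>.\<close>

lemma final_pbc_factor_pullback:
  assumes f: "final_pbc C b (n \<cdot> c) a d" and n: "monomorphism C n"
    and f': "final_pbc C b c a' d'" and hc: "c \<in> hom C B M" and hn: "n \<in> hom C M X"
    and hu: "u \<in> hom C (Cod C a') (Cod C a)"
    and u: "u \<cdot> a' = a" "d \<cdot> u = n \<cdot> d'"
  shows "is_pullback C d' u n d"
proof -
  note pb = final_pbc_pullback[OF f] and pb' = final_pbc_pullback[OF f']
  from pb' hc obtain A D' where h1: "b \<in> hom C A B" "a' \<in> hom C A D'" "d' \<in> hom C D' M"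
    "c \<cdot> b = d' \<cdot> a'" by (elim pullbackE) (auto simp: hom_def)
  from pb h1 comp_hom[OF hc hn] obtain D where "a \<in> hom C A D" "d \<in> hom C D X"
    by (elim pullbackE) (auto simp: hom_def)
  note h = h1(1,2) hc h1(3,4) this
  have hu: "u \<in> hom C D' D" using hu h by (simp add: hom_def)
  note nc = comp_hom[OF h(3) hn]
  show ?thesis
  proof (rule pullbackI[OF h(4) hu hn h(7) u(2)[symmetric]])
    fix T x y assume xy: "x \<in> hom C T M" "y \<in> hom C T D" "n \<cdot> x = d \<cdot> y"
    obtain s1 s2 where s: "is_pullback C s1 s2 c x"
      using has_pullbacks[of c x] h xy by (auto simp: hom_def)
    then obtain S where hs: "s1 \<in> hom C S B" "s2 \<in> hom C S T" "c \<cdot> s1 = x \<cdot> s2"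
      using h xy by (elim pullbackE) (auto simp: hom_def)
    have "(n \<cdot> c) \<cdot> s1 = d \<cdot> (y \<cdot> s2)"
      using hs h hn xy comp_reassoc[OF xy(3,1) hn] by (simp add: cat_simps)
    \<comment> \<open>A competitor needs a factorization of \<open>s1\<close> through
      \<open>b\<close>. Taking it from the pullback underlying \<open>f\<close>, applied to
      \<open>s1\<close> and \<open>y \<cdot> s2\<close>, makes \<open>y\<close> itself a mediating
      arrow.\<close>
    then obtain e where e: "e \<in> hom C S A" "b \<cdot> e = s1" "a \<cdot> e = y \<cdot> s2"
      using pullback_lift[OF pb h(1,6) hs(1) comp_hom[OF hs(2) xy(2)]] by blast
    with s obtain g where g: "g \<in> hom C T D'" "g \<cdot> s2 = a' \<cdot> e" "d' \<cdot> g = x"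
      using final_pbc_lift[OF f' h(1,4) _ e(1) xy(1)] by blast
    have dug: "d \<cdot> (u \<cdot> g) = n \<cdot> x"
      using g hu h hn comp_reassoc[OF u(2) hu h(7)] by (simp add: cat_simps)
    have "is_pullback C (b \<cdot> e) s2 (n \<cdot> c) (d \<cdot> (u \<cdot> g))"
      using pullback_mono_postcomp[OF s n hn h(3)] dug e by simp
    moreover have "(u \<cdot> g) \<cdot> s2 = a \<cdot> e"
      using g hs hu h e comp_reassoc[OF u(1) h(2) hu] by (simp add: cat_simps)
    ultimately have "u \<cdot> g = y"
      using final_pbc_ext[OF f h(1,7) _ e(1) comp_hom[OF g(1) hu] xy(2)] e(3) dug xy(3) by simp
    with g show "\<exists>g\<in>hom C T D'. d' \<cdot> g = x \<and> u \<cdot> g = y" by blast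
  next
    fix T g k assume g: "g \<in> hom C T D'" "k \<in> hom C T D'" "d' \<cdot> g = d' \<cdot> k" "u \<cdot> g = u \<cdot> k"
    obtain s1 s2 where s: "is_pullback C s1 s2 c (d' \<cdot> g)"
      using has_pullbacks[of c "d' \<cdot> g"] h g by (auto simp: cat_simps)
    then obtain S where hs: "s1 \<in> hom C S B" "s2 \<in> hom C S T" "c \<cdot> s1 = (d' \<cdot> g) \<cdot> s2"
      using h comp_hom[OF g(1) h(4)] by (elim pullbackE) (auto simp: hom_def)
    \<comment> \<open>The arrows \<open>g\<close> and \<open>k\<close> each induce a factorization
      of \<open>s1\<close> through \<open>b\<close>. Since \<open>u \<cdot> g = u \<cdot> k\<close>,
      the two have the same composite with \<open>a\<close> and so coincide; hence \<open>g\<close>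
      and \<open>k\<close> mediate the same competitor of \<open>f'\<close>.\<close>
    obtain e where e: "e \<in> hom C S A" "b \<cdot> e = s1" "a' \<cdot> e = g \<cdot> s2"
      using pullback_lift[OF pb' h(1,2) hs(1) comp_hom[OF hs(2) g(1)]] hs(3)
        comp_assoc[OF hs(2) g(1) h(4)] by auto
    obtain e2 where e2: "e2 \<in> hom C S A" "b \<cdot> e2 = s1" "a' \<cdot> e2 = k \<cdot> s2"
      using pullback_lift[OF pb' h(1,2) hs(1) comp_hom[OF hs(2) g(2)]] hs(3)
        comp_assoc[OF hs(2) g(2) h(4)] g(3) by auto
    have "a \<cdot> e = u \<cdot> (g \<cdot> s2)" "a \<cdot> e2 = u \<cdot> (k \<cdot> s2)"
      using comp_assoc[OF e(1) h(2) hu] comp_assoc[OF e2(1) h(2) hu] e e2 u(1) by simp_all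
    then have "a \<cdot> e = a \<cdot> e2"
      using comp_assoc[OF hs(2) g(1) hu] comp_assoc[OF hs(2) g(2) hu] g(4) by simp
    then have "e = e2"
      using pullback_ext[OF pb h(1) e(1) e2(1)] e e2 by simp
    with e e2 s show "g = k"
      using final_pbc_ext[OF f' h(1,4) _ e(1) g(1,2)] g(3) by simp
  qed
qed

text \<open>Finality for \<open>f\<close> speaks only of pullbacks over \<open>n \<cdot> c\<close>,
  so a competitor over \<open>n\<close> is first restricted along the pullback of \<open>c\<close>
  and \<open>d' \<cdot> e\<close>. Finality then gives the mediating arrow, and its uniqueness
  clause removes the restriction from the equation that this arrow has to satisfy.\<close>

lemma final_pbc_cancel:
  assumes f: "final_pbc C b (n \<cdot> c) (u \<cdot> a') d" and n: "monomorphism C n"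
    and l: "is_pullback C b a' c d'" and r: "is_pullback C d' u n d"
  shows "final_pbc C d' n u d"
proof -
  from l obtain A B D' M where h: "b \<in> hom C A B" "a' \<in> hom C A D'" "c \<in> hom C B M"
    "d' \<in> hom C D' M" "c \<cdot> b = d' \<cdot> a'" by (rule pullbackE)
  with r obtain D X where i: "u \<in> hom C D' D" "n \<in> hom C M X" "d \<in> hom C D X" "n \<cdot> d' = d \<cdot> u"
    by (elim pullbackE) (auto simp: hom_def)
  \<comment> \<open>The restriction yields two pullbacks over \<open>n \<cdot> c\<close>: one ending
    in \<open>E\<close>, for comparing arrows from \<open>E\<close> to \<open>D\<close>, and one
    ending in the domain of \<open>d1\<close>, for finding and comparing mediating arrows.\<close>
  have key: "\<exists>S s2 e3. e3 \<in> hom C S A \<and> s2 \<in> hom C S E \<and> a' \<cdot> e3 = e \<cdot> s2 \<and>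
      is_pullback C (b \<cdot> e3) s2 (n \<cdot> c) (n \<cdot> (d' \<cdot> e)) \<and>
      is_pullback C (b \<cdot> e3) (a1 \<cdot> s2) (n \<cdot> c) d1"
    if p: "is_pullback C (d' \<cdot> e) a1 n d1" and e: "e \<in> hom C E D'" for e E a1 d1
  proof -
    note de = comp_hom[OF e h(4)]
    obtain s1 s2 where s: "is_pullback C s1 s2 c (d' \<cdot> e)"
      using has_pullbacks[of c "d' \<cdot> e"] h de by (auto simp: hom_def)
    then obtain S where hs: "s1 \<in> hom C S B" "s2 \<in> hom C S E" "c \<cdot> s1 = (d' \<cdot> e) \<cdot> s2"
      using h de by (elim pullbackE) (auto simp: hom_def)
    then obtain e3 where e3: "e3 \<in> hom C S A" "b \<cdot> e3 = s1" "a' \<cdot> e3 = e \<cdot> s2"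
      using pullback_lift[OF l h(1,2) hs(1) comp_hom[OF hs(2) e]] comp_assoc[OF hs(2) e h(4)] by auto
    show ?thesis
      using e3 hs pullback_mono_postcomp[OF s n i(2) h(3)]
        is_pullback_sym[OF pullback_paste[OF is_pullback_sym[OF p] is_pullback_sym[OF s]]] by blast
  qed
  show ?thesis
  proof (rule final_pbcI[OF r h(4) i(3)])
    fix E D1 a1 d1 e
    assume p: "is_pullback C (d' \<cdot> e) a1 n d1"
      and e: "e \<in> hom C E D'" "a1 \<in> hom C E D1" "d1 \<in> hom C D1 X"
    from key[OF p e(1)] obtain S s2 e3 where s: "e3 \<in> hom C S A" "s2 \<in> hom C S E"
      "a' \<cdot> e3 = e \<cdot> s2" "is_pullback C (b \<cdot> e3) s2 (n \<cdot> c) (n \<cdot> (d' \<cdot> e))"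
      "is_pullback C (b \<cdot> e3) (a1 \<cdot> s2) (n \<cdot> c) d1" by blast
    obtain g where g: "g \<in> hom C D1 D" "g \<cdot> (a1 \<cdot> s2) = (u \<cdot> a') \<cdot> e3" "d \<cdot> g = d1"
      by (rule final_pbc_lift[OF f h(1) i(3) s(5) s(1) e(3)])
    have pe: "n \<cdot> (d' \<cdot> e) = d1 \<cdot> a1" using p by (rule pullbackE)
    have dg: "d \<cdot> (g \<cdot> a1) = n \<cdot> (d' \<cdot> e)"
      using comp_assoc[OF e(2) g(1) i(3)] g(3) pe by simp
    have du: "d \<cdot> (u \<cdot> e) = n \<cdot> (d' \<cdot> e)"
      using e h i comp_reassoc[OF i(4) h(4) i(2)] by (simp add: cat_simps)
    have "(g \<cdot> a1) \<cdot> s2 = (u \<cdot> a') \<cdot> e3"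
      using g comp_assoc[OF s(2) e(2) g(1)] by simp
    moreover have "(u \<cdot> e) \<cdot> s2 = (u \<cdot> a') \<cdot> e3"
      using comp_assoc[OF s(2) e(1) i(1)] comp_assoc[OF s(1) h(2) i(1)] s(3) by simp
    \<comment> \<open>Both sides have the same composite with \<open>d\<close> and agree after
      \<open>s2\<close>, so they mediate the same competitor, namely the restricted square over
      \<open>n \<cdot> (d' \<cdot> e)\<close>.\<close>
    ultimately have "g \<cdot> a1 = u \<cdot> e"
      using final_pbc_ext[OF f h(1) i(3) _ s(1) comp_hom[OF e(2) g(1)] comp_hom[OF e(1) i(1)]]
        s(4) dg du by simp
    with g show "\<exists>g\<in>hom C D1 D. g \<cdot> a1 = u \<cdot> e \<and> d \<cdot> g = d1" by blast
  next
    fix E D1 a1 e g k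
    assume p: "is_pullback C (d' \<cdot> e) a1 n (d \<cdot> g)"
      and e: "e \<in> hom C E D'" "a1 \<in> hom C E D1"
      and g: "g \<in> hom C D1 D" "k \<in> hom C D1 D" "g \<cdot> a1 = u \<cdot> e" "k \<cdot> a1 = u \<cdot> e" "d \<cdot> g = d \<cdot> k"
    from key[OF p e(1)] obtain S s2 e3 where s: "e3 \<in> hom C S A" "s2 \<in> hom C S E"
      "a' \<cdot> e3 = e \<cdot> s2" "is_pullback C (b \<cdot> e3) (a1 \<cdot> s2) (n \<cdot> c) (d \<cdot> g)" by blast
    have "(u \<cdot> e) \<cdot> s2 = (u \<cdot> a') \<cdot> e3"
      using comp_assoc[OF s(2) e(1) i(1)] comp_assoc[OF s(1) h(2) i(1)] s(3) by simp
    then have "g \<cdot> (a1 \<cdot> s2) = (u \<cdot> a') \<cdot> e3" "k \<cdot> (a1 \<cdot> s2) = (u \<cdot> a') \<cdot> e3"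
      using comp_assoc[OF s(2) e(2) g(1)] comp_assoc[OF s(2) e(2) g(2)] g by simp_all
    then show "g = k"
      using final_pbc_ext[OF f h(1) i(3) s(4,1) g(1,2)] g(5) by blast
  qed
qed

lemma final_pbc_factor:
  assumes f: "final_pbc C b (n \<cdot> c) a d" and n: "monomorphism C n" and f': "final_pbc C b c a' d'"
    and hc: "c \<in> hom C B M" and hn: "n \<in> hom C M X"
  obtains u where
    "is_the_unique (\<lambda>u. u \<in> hom C (Cod C a') (Cod C a) \<and> u \<cdot> a' = a \<and> d \<cdot> u = n \<cdot> d') u"
    "final_pbc C d' n u d" "monomorphism C u"
proof -
  note pb = final_pbc_pullback[OF f] and pb' = final_pbc_pullback[OF f']
  from pb' hc obtain A D' where h: "b \<in> hom C A B" "a' \<in> hom C A D'" "d' \<in> hom C D' M"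
    "c \<cdot> b = d' \<cdot> a'" by (elim pullbackE) (auto simp: hom_def)
  from pb h comp_hom[OF hc hn] obtain D where i: "a \<in> hom C A D" "d \<in> hom C D X"
    by (elim pullbackE) (auto simp: hom_def)
  \<comment> \<open>The square of \<open>f'\<close>, postcomposed with \<open>n\<close>, competes
    for \<open>f\<close> with \<open>e\<close> an identity; the mediating arrow is the desired
    \<open>u\<close>.\<close>
  have p: "is_pullback C (b \<cdot> Id C A) a' (n \<cdot> c) (n \<cdot> d')"
    using pullback_mono_postcomp[OF pb' n hn hc] comp_id(1)[OF h(1)] by simp
  obtain u where u: "u \<in> hom C D' D" "u \<cdot> a' = a \<cdot> Id C A" "d \<cdot> u = n \<cdot> d'"
    by (rule final_pbc_lift[OF f h(1) i(2) p id_hom(1)[OF h(1)] comp_hom[OF h(3) hn]])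
  have cods: "Cod C a' = D'" "Cod C a = D" using h i by (auto simp: hom_def)
  have ua: "u \<cdot> a' = a" using u comp_id(1)[OF i(1)] by simp
  have "v = u" if "v \<in> hom C D' D" "v \<cdot> a' = a" "d \<cdot> v = n \<cdot> d'" for v
    using final_pbc_ext[OF f h(1) i(2) _ id_hom(1)[OF h(1)] that(1) u(1), of a'] p that u ua by simp
  then have "is_the_unique (\<lambda>u. u \<in> hom C (Cod C a') (Cod C a) \<and> u \<cdot> a' = a \<and> d \<cdot> u = n \<cdot> d') u"
    unfolding is_the_unique_def cods using u(1,3) ua by blast
  moreover have r: "is_pullback C d' u n d"
    using final_pbc_factor_pullback[OF f n f' hc hn _ ua u(3)] u(1) cods by simp
  moreover have "final_pbc C d' n u d"
    using final_pbc_cancel[OF _ n pb' r] f ua by simp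
  moreover have "monomorphism C u" by (rule mono_pullback[OF r n])
  ultimately show thesis using that by blast
qed

subsection \<open>Pushouts along monomorphisms and effective unions\<close>

text \<open>The direction of the van Kampen condition that passes from pullback front faces to a
  pushout on top.\<close>

lemma pushout_stable:
  assumes "is_pushout C m f g n" "monomorphism C m" "commuting_square C m' f' g' n'"
    and "is_pullback C m' c b m" "is_pullback C f' c a f"
    and "is_pullback C g' b d g" "is_pullback C n' a d n"
  shows "is_pushout C m' f' g' n'"
proof -
  have "commuting_square C g' b d g" "commuting_square C n' a d n"
    using assms by (auto simp: is_pullback_def)
  with pushouts_along_monos_van_kampen[OF assms(1,2)] assms show ?thesis
    unfolding van_kampen_def by meson
qed

text \<open>Apply the van Kampen condition to the cube whose top is the trivial pushout of an
  identity and \<open>f\<close>, with vertical arrows \<open>m\<close>, \<open>n\<close> and two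
  identities. Its front faces are then pullbacks: one is the given square, the other says that the
  kernel pair of \<open>n\<close> is trivial.\<close>

lemma pushout_mono:
  assumes po: "is_pushout C m f g n" and m: "monomorphism C m"
  shows "is_pullback C f m n g" "monomorphism C n"
proof -
  from po obtain A B A' D where h: "m \<in> hom C A B" "f \<in> hom C A A'" "g \<in> hom C B D"
    "n \<in> hom C A' D" "g \<cdot> m = n \<cdot> f" by (rule pushoutE)
  have "is_pullback C (Id C A) (Id C A) m m"
    using pullback_mono_id[OF m h(1) id_hom(1)[OF h(1)]] comp_id(1)[OF h(1)] by simp
  moreover have "is_pullback C f (Id C A) (Id C A') f" by (rule pullback_id[OF h(2)])
  moreover have "commuting_square C f m n g" using h commuting_squareI by metis
  moreover have "commuting_square C (Id C A') (Id C A') n n"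
    using commuting_squareI[OF id_hom(2)[OF h(2)] id_hom(2)[OF h(2)] h(4,4)] by simp
  moreover have po': "is_pushout C (Id C A) f f (Id C A')" by (rule pushout_id[OF h(2)])
  moreover have "commuting_square C (Id C A) f f (Id C A')" using po' by (simp add: is_pushout_def)
  ultimately have *: "is_pullback C f m n g \<and> is_pullback C (Id C A') (Id C A') n n"
    using pushouts_along_monos_van_kampen[OF po m] unfolding van_kampen_def by meson
  then show "is_pullback C f m n g" by blast
  have pn: "is_pullback C (Id C A') (Id C A') n n" using * by blast
  show "monomorphism C n"
  proof (rule monoI[OF h(4)])
    fix X u v assume uv: "u \<in> hom C X A'" "v \<in> hom C X A'" "n \<cdot> u = n \<cdot> v"
    obtain w where "w \<in> hom C X A'" "Id C A' \<cdot> w = u" "Id C A' \<cdot> w = v"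
      by (rule pullback_lift[OF pn id_hom(2)[OF h(2)] id_hom(2)[OF h(2)] uv])
    then show "u = v" by simp
  qed
qed

text \<open>Pulling the legs of the pushout back along \<open>d\<close> presents \<open>K\<close> as
  a pushout again, by stability, so \<open>q1\<close> and \<open>q2\<close> are jointly
  epic.\<close>

lemma pushout_cover_ext:
  assumes po: "is_pushout C m f g n" and m: "monomorphism C m"
    and q1: "is_pullback C q1 p1 d g" and q2: "is_pullback C q2 p2 d n"
    and d: "d \<in> hom C K Z" and uv: "u \<in> hom C K T" "v \<in> hom C K T"
    and eq: "u \<cdot> q1 = v \<cdot> q1" "u \<cdot> q2 = v \<cdot> q2"
  shows "u = v"
proof -
  from q1 d obtain B K1 where h: "q1 \<in> hom C K1 K" "p1 \<in> hom C K1 B" "g \<in> hom C B Z"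
    "d \<cdot> q1 = g \<cdot> p1" by (elim pullbackE) (auto simp: hom_def)
  from q2 d obtain A' K2 where i: "q2 \<in> hom C K2 K" "p2 \<in> hom C K2 A'" "n \<in> hom C A' Z"
    "d \<cdot> q2 = n \<cdot> p2" by (elim pullbackE) (auto simp: hom_def)
  from po h i obtain A where j: "m \<in> hom C A B" "f \<in> hom C A A'" "g \<cdot> m = n \<cdot> f"
    by (elim pushoutE) (auto simp: hom_def)
  obtain m' c where pm: "is_pullback C m' c p1 m"
    using has_pullbacks[of p1 m] h j by (auto simp: hom_def)
  with h j obtain J where k: "m' \<in> hom C J K1" "c \<in> hom C J A" "p1 \<cdot> m' = m \<cdot> c"
    by (elim pullbackE) (auto simp: hom_def)
  \<comment> \<open>This equation produces \<open>f'\<close>, the missing edge in the top face of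
    the cube over the pushout; the face over \<open>f\<close> is then a pullback by cancellation
    against \<open>q2\<close>.\<close>
  have "d \<cdot> (q1 \<cdot> m') = n \<cdot> (f \<cdot> c)"
    using d h i j k comp_reassoc[OF h(4,1) d] comp_reassoc[OF j(3,1) h(3)] by (simp add: cat_simps)
  then obtain f' where f': "f' \<in> hom C J K2" "q2 \<cdot> f' = q1 \<cdot> m'" "p2 \<cdot> f' = f \<cdot> c"
    by (rule pullback_lift[OF q2 i(1,2) comp_hom[OF k(1) h(1)] comp_hom[OF k(2) j(2)]])
  have "is_pullback C (q2 \<cdot> f') c d (n \<cdot> f)"
    using pullback_paste[OF q1 pm] f' j(3) by simp
  then have "is_pullback C f' c p2 f"
    using pullback_cancel[OF q2 _ commuting_squareI[OF f'(1) k(2) i(2) j(2) f'(3)]] by blast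
  then have "is_pushout C m' f' q1 q2"
    using pushout_stable[OF po m _ pm _ q1 q2]
      commuting_squareI[OF k(1) f'(1) h(1) i(1) f'(2)[symmetric]] by blast
  then show ?thesis using pushout_ext[OF _ h(1) uv eq] by blast
qed

text \<open>Half of the proof that \<open>h\<close> is mono: one of the two arrows compared is
  assumed to factor through \<open>i\<close>. The equation is tested on the cover of
  \<open>K\<close> obtained by pulling \<open>i\<close> and \<open>j\<close> back along
  \<open>g\<close>. On the first piece \<open>s\<close> cancels; on the second,
  \<open>f \<cdot> q2\<close> and \<open>p2\<close> factor through the intersection
  \<open>D\<close>, where \<open>i \<cdot> x = j \<cdot> y\<close>.\<close>

lemma union_comp_eq:
  assumes pb: "is_pullback C x y s t" and po: "is_pushout C x y i j" and s: "monomorphism C s"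
    and t: "monomorphism C t" and h: "h \<in> hom C H Z" and hom: "i \<in> hom C A H" "j \<in> hom C B H"
    and hi: "h \<cdot> i = s" and hj: "h \<cdot> j = t"
    and f: "f \<in> hom C K A" and g: "g \<in> hom C K H" and eq: "s \<cdot> f = h \<cdot> g"
  shows "i \<cdot> f = g"
proof -
  have x: "monomorphism C x" using mono_pullback[OF is_pullback_sym[OF pb] t] .
  have st: "s \<in> hom C A Z" "t \<in> hom C B Z" using hi hj comp_hom h hom by auto
  with pb obtain D where xy: "x \<in> hom C D A" "y \<in> hom C D B" "s \<cdot> x = t \<cdot> y"
    by (elim pullbackE) (auto simp: hom_def)
  have ij: "i \<cdot> x = j \<cdot> y" using po by (rule pushoutE)
  obtain q1 p1 where q1: "is_pullback C q1 p1 g i"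
    using has_pullbacks[of g i] g hom by (auto simp: hom_def)
  with g hom obtain K1 where k1: "q1 \<in> hom C K1 K" "p1 \<in> hom C K1 A" "g \<cdot> q1 = i \<cdot> p1"
    by (elim pullbackE) (auto simp: hom_def)
  obtain q2 p2 where q2: "is_pullback C q2 p2 g j"
    using has_pullbacks[of g j] g hom by (auto simp: hom_def)
  with g hom obtain K2 where k2: "q2 \<in> hom C K2 K" "p2 \<in> hom C K2 B" "g \<cdot> q2 = j \<cdot> p2"
    by (elim pullbackE) (auto simp: hom_def)
  have "s \<cdot> (f \<cdot> q1) = s \<cdot> p1"
    using comp_reassoc[OF eq f st(1)] comp_reassoc[OF hi hom(1) h] k1 h g f hom st
      by (simp add: cat_simps)
  then have "f \<cdot> q1 = p1"
    using mono_cancel[OF s st(1) comp_hom[OF k1(1) f] k1(2)] by blast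
  then have 1: "(i \<cdot> f) \<cdot> q1 = g \<cdot> q1"
    using comp_assoc[OF k1(1) f hom(1)] k1(3) by simp
  have "s \<cdot> (f \<cdot> q2) = t \<cdot> p2"
    using comp_reassoc[OF eq f st(1)] comp_reassoc[OF hj hom(2) h] k2 h g f hom st
      by (simp add: cat_simps)
  then obtain w where w: "w \<in> hom C K2 D" "x \<cdot> w = f \<cdot> q2" "y \<cdot> w = p2"
    by (rule pullback_lift[OF pb xy(1,2) comp_hom[OF k2(1) f] k2(2)])
  have "i \<cdot> (x \<cdot> w) = j \<cdot> (y \<cdot> w)"
    using comp_assoc[OF w(1) xy(1) hom(1)] comp_assoc[OF w(1) xy(2) hom(2)] ij by simp
  then have 2: "(i \<cdot> f) \<cdot> q2 = g \<cdot> q2"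
    using comp_assoc[OF k2(1) f hom(1)] k2(3) w by simp
  show ?thesis
    by (rule pushout_cover_ext[OF po x q1 q2 g comp_hom[OF f hom(1)] g 1 2])
qed

text \<open>Effectiveness of unions. Pulling \<open>i\<close> and \<open>j\<close> back along
  \<open>u\<close> covers \<open>K\<close> by pieces on which \<open>u\<close> factors through one
  of the two subobjects; there \<open>union_comp_eq\<close> applies, the second time with the roles
  of the subobjects exchanged.\<close>

lemma union_mono:
  assumes pb: "is_pullback C x y s t" and po: "is_pushout C x y i j" and s: "monomorphism C s"
    and t: "monomorphism C t" and h: "h \<in> hom C H Z" and hom: "i \<in> hom C A H" "j \<in> hom C B H"
    and hi: "h \<cdot> i = s" and hj: "h \<cdot> j = t"
  shows "monomorphism C h"
proof (rule monoI[OF h])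
  fix K u v assume uv: "u \<in> hom C K H" "v \<in> hom C K H" "h \<cdot> u = h \<cdot> v"
  have x: "monomorphism C x" using mono_pullback[OF is_pullback_sym[OF pb] t] .
  obtain q1 p1 where q1: "is_pullback C q1 p1 u i"
    using has_pullbacks[of u i] uv hom by (auto simp: hom_def)
  with uv hom obtain K1 where k1: "q1 \<in> hom C K1 K" "p1 \<in> hom C K1 A" "u \<cdot> q1 = i \<cdot> p1"
    by (elim pullbackE) (auto simp: hom_def)
  obtain q2 p2 where q2: "is_pullback C q2 p2 u j"
    using has_pullbacks[of u j] uv hom by (auto simp: hom_def)
  with uv hom obtain K2 where k2: "q2 \<in> hom C K2 K" "p2 \<in> hom C K2 B" "u \<cdot> q2 = j \<cdot> p2"
    by (elim pullbackE) (auto simp: hom_def)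
  have "s \<cdot> p1 = h \<cdot> (v \<cdot> q1)"
    using comp_assoc[OF k1(2) hom(1) h] comp_assoc[OF k1(1) uv(1) h]
      comp_assoc[OF k1(1) uv(2) h] k1(3) uv(3) hi by simp
  then have 1: "u \<cdot> q1 = v \<cdot> q1"
    using union_comp_eq[OF pb po s t h hom hi hj k1(2) comp_hom[OF k1(1) uv(2)]] k1(3) by simp
  have "t \<cdot> p2 = h \<cdot> (v \<cdot> q2)"
    using comp_assoc[OF k2(2) hom(2) h] comp_assoc[OF k2(1) uv(1) h]
      comp_assoc[OF k2(1) uv(2) h] k2(3) uv(3) hj by simp
  then have 2: "u \<cdot> q2 = v \<cdot> q2"
    using union_comp_eq[OF is_pullback_sym[OF pb] is_pushout_sym[OF po] t s h hom(2,1) hj hi k2(2)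
        comp_hom[OF k2(1) uv(2)]] k2(3) by simp
  show "u = v"
    by (rule pushout_cover_ext[OF po x q1 q2 uv(1,1,2) 1 2])
qed

end

subsection \<open>Composition of rewriting steps\<close>

theorem theorem1:
  fixes C :: "('o, 'a, 'z) category_data_scheme" (structure)
  assumes adhesive: "adhesive_category C"
    and pushouts: "has_all_pushouts C"
    and final_pbcs: "has_final_pbcs_over_monos C"
    and rewriting1: "reversible_sqpo_rewriting C r1m r1p m1 m1m g1m g1p m1p"
    and rewriting2: "sqpo_rewriting C r2m r2p m2 m2m g2m g2p m2p"
    and G2: "Cod C m2 = Cod C m1p"
    and D: "is_pullback C x y m1p m2"
    and H: "is_pushout C x y r1H l2H"
    and P1H: "final_pbc C r1p r1H p1H h1p"
    and P2H: "final_pbc C r2m l2H p2H h2m"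
    and L: "is_pushout C r1m p1H l1H h1m"
    and R: "is_pushout C r2p p2H r2H h2p"
    and P: "is_pullback C p' p'' h1p h2m"
  shows "\<exists>mH m1H m.
    is_the_unique (\<lambda>u. u \<in> hom C (Cod C r1H) (Cod C m1p) \<and> u \<cdot> r1H = m1p \<and> u \<cdot> l2H = m2) mH \<and>
    is_the_unique (\<lambda>u. u \<in> hom C (Cod C p1H) (Cod C m1m) \<and> u \<cdot> p1H = m1m \<and> g1p \<cdot> u = mH \<cdot> h1p) m1H \<and>
    is_the_unique (\<lambda>u. u \<in> hom C (Cod C l1H) (Cod C m1) \<and> u \<cdot> l1H = m1 \<and> u \<cdot> h1m = g1m \<cdot> m1H) m \<and>
    monomorphism C m \<and>
    (\<exists>mm gm gp mp.
       sqpo_rewriting C (h1m \<cdot> p') (h2p \<cdot> p'') m mm gm gp mp \<and>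
       Cod C gm = Cod C m1 \<and> Cod C gp = Cod C g2p \<and>
       monomorphism C mm \<and> monomorphism C mp)"
proof -
  interpret adhesive_category C by (rule adhesive)
  from rewriting1 have m1: "monomorphism C m1" and f1: "final_pbc C r1m m1 m1m g1m"
    and po1: "is_pushout C m1m r1p g1p m1p" and po1': "is_pushout C r1m m1m m1 g1m"
    and f1': "final_pbc C r1p m1p m1m g1p"
    by (auto simp: reversible_sqpo_rewriting_def sqpo_rewriting_def rule_instance_def)
  from rewriting2 have m2: "monomorphism C m2" and f2: "final_pbc C r2m m2 m2m g2m"
    and po2: "is_pushout C m2m r2p g2p m2p"
    by (auto simp: sqpo_rewriting_def rule_instance_def)
  have m1p: "monomorphism C m1p"
    using pushout_mono(2)[OF po1 mono_pullback[OF final_pbc_pullback[OF f1] m1]] .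
  have y: "monomorphism C y" using mono_pullback[OF D m1p] .
  have r1H: "monomorphism C r1H" using pushout_mono(2)[OF is_pushout_sym[OF H] y] .
  have p1H: "monomorphism C p1H" using mono_pullback[OF final_pbc_pullback[OF P1H] r1H] .
  from H obtain HH where homH: "r1H \<in> hom C (Cod C x) HH" "l2H \<in> hom C (Cod C y) HH"
    by (elim pushoutE) (auto simp: hom_def)
  from D obtain Z where hom2: "m1p \<in> hom C (Cod C x) Z" "m2 \<in> hom C (Cod C y) Z"
    by (elim pullbackE) (auto simp: hom_def)
  have "commuting_square C x y m1p m2" using D by (simp add: is_pullback_def)
  with H obtain mH where mH: "is_the_unique
      (\<lambda>u. u \<in> hom C (Cod C r1H) (Cod C m1p) \<and> u \<cdot> r1H = m1p \<and> u \<cdot> l2H = m2) mH"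
    by (rule pushout_desc_unique)
  then have mH': "mH \<in> hom C HH Z" "mH \<cdot> r1H = m1p" "mH \<cdot> l2H = m2"
    using homH hom2 by (auto simp: is_the_unique_def hom_def)
  have mH_mono: "monomorphism C mH" by (rule union_mono[OF D H m1p m2 mH'(1) homH mH'(2,3)])
  \<comment> \<open>Reversibility provides a final pullback complement on the right-hand side of the
    first step. Reading \<open>m1p\<close> as \<open>mH \<cdot> r1H\<close> lets it be split, with
    \<open>m1H\<close> as the comparison of the two complements.\<close>
  have "final_pbc C r1p (mH \<cdot> r1H) m1m g1p" using f1' mH' by simp
  then obtain m1H where m1H: "is_the_unique
      (\<lambda>u. u \<in> hom C (Cod C p1H) (Cod C m1m) \<and> u \<cdot> p1H = m1m \<and> g1p \<cdot> u = mH \<cdot> h1p) m1H"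
    and fH1: "final_pbc C h1p mH m1H g1p" and m1H_mono: "monomorphism C m1H"
    by (rule final_pbc_factor[OF _ mH_mono P1H homH(1) mH'(1)])
  have m1H': "m1H \<in> hom C (Cod C p1H) (Cod C m1m)" "m1H \<cdot> p1H = m1m"
    using m1H by (auto simp: is_the_unique_def)
  note pbH1 = final_pbc_pullback[OF fH1]
  have "final_pbc C r2m (mH \<cdot> l2H) m2m g2m" using f2 mH' by simp
  then obtain m2H where m2H: "is_the_unique
      (\<lambda>u. u \<in> hom C (Cod C p2H) (Cod C m2m) \<and> u \<cdot> p2H = m2m \<and> g2m \<cdot> u = mH \<cdot> h2m) m2H"
    and fH2: "final_pbc C h2m mH m2H g2m" and m2H_mono: "monomorphism C m2H"
    by (rule final_pbc_factor[OF _ mH_mono P2H homH(2) mH'(1)])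
  have m2H': "m2H \<in> hom C (Cod C p2H) (Cod C m2m)" "m2H \<cdot> p2H = m2m"
    using m2H by (auto simp: is_the_unique_def)
  note pbH2 = final_pbc_pullback[OF fH2]
  \<comment> \<open>Reversibility also makes the left-hand square a pushout; splitting it along
    \<open>m1H\<close> produces \<open>m\<close>.\<close>
  have "is_pushout C r1m (m1H \<cdot> p1H) m1 g1m" using po1' m1H' by simp
  then obtain m where m: "is_the_unique
      (\<lambda>u. u \<in> hom C (Cod C l1H) (Cod C m1) \<and> u \<cdot> l1H = m1 \<and> u \<cdot> h1m = g1m \<cdot> m1H) m"
    and poL: "is_pushout C h1m m1H m g1m"
    by (rule pushout_factor[OF L _ m1H'(1)])
  have "is_pushout C r2p (m2H \<cdot> p2H) m2p g2p" using is_pushout_sym[OF po2] m2H' by simp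
  then obtain mR where poR: "is_pushout C h2p m2H mR g2p"
    by (rule pushout_factor[OF R _ m2H'(1)]) (rule that)
  note m_mono = pushout_mono(2)[OF is_pushout_sym[OF poL] m1H_mono]
  note mR_mono = pushout_mono(2)[OF is_pushout_sym[OF poR] m2H_mono]
  have "is_pullback C r1m p1H l1H h1m" by (rule pushout_mono(1)[OF is_pushout_sym[OF L] p1H])
  moreover have "is_pullback C h1m m1H m g1m"
    by (rule pushout_mono(1)[OF is_pushout_sym[OF poL] m1H_mono])
  \<comment> \<open>The left square of the first step, read as a composite. Both of its halves are
    pushouts along monos, hence pullbacks, so the half over \<open>m\<close> inherits finality by
    cancellation.\<close>
  moreover have "final_pbc C r1m (m \<cdot> l1H) (m1H \<cdot> p1H) g1m"
    using f1 m m1H' by (simp add: is_the_unique_def)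
  ultimately have fL: "final_pbc C h1m m m1H g1m"
    using final_pbc_cancel m_mono by blast
  \<comment> \<open>Base change of the first step's pushout along \<open>mH\<close> shows that the
    square of \<open>P1H\<close> is a pushout; cancelling it from the whole leaves the claimed one.
    The two identity arrows of the cube come from \<open>m1m\<close> and \<open>m1p\<close>
    factoring through monos.\<close>
  have poH: "is_pushout C m1H h1p g1p mH"
  proof -
    from po1 obtain P1 R1 where h: "m1m \<in> hom C P1 (Cod C m1m)" "r1p \<in> hom C P1 R1"
      by (elim pushoutE) (auto simp: hom_def)
    from final_pbc_pullback[OF P1H] h have p: "p1H \<in> hom C P1 (Cod C p1H)"
      by (elim pullbackE) (auto simp: hom_def)
    have "is_pullback C p1H (Id C P1) m1H m1m"
      using pullback_mono_id[OF m1H_mono m1H'(1) p] m1H' by simp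
    moreover have "is_pullback C r1p (Id C P1) (Id C R1) r1p" by (rule pullback_id[OF h(2)])
    moreover have "Cod C x = R1"
      using po1 h hom2 by (elim pushoutE) (auto simp: hom_def)
    then have "is_pullback C r1H (Id C R1) mH m1p"
      using pullback_mono_id[OF mH_mono mH'(1) homH(1)] mH' by simp
    moreover have "commuting_square C p1H r1p h1p r1H"
      using final_pbc_pullback[OF P1H] by (auto simp: is_pullback_def commuting_square_def)
    ultimately have "is_pushout C p1H r1p h1p r1H"
      using pushout_stable[OF po1] mono_pullback[OF final_pbc_pullback[OF f1] m1] pbH1 by blast
    then have "is_pushout C r1p p1H r1H h1p" by (rule is_pushout_sym)
    moreover have "is_pushout C r1p (m1H \<cdot> p1H) (mH \<cdot> r1H) g1p"
      using is_pushout_sym[OF po1] m1H' mH' by simp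
    moreover have "commuting_square C h1p m1H mH g1p" using pbH1 by (simp add: is_pullback_def)
    ultimately show ?thesis using is_pushout_sym[OF pushout_cancel] by blast
  qed
  from pbH1 obtain P1' G1' where h1: "h1p \<in> hom C P1' HH" "m1H \<in> hom C P1' G1'"
    "g1p \<in> hom C G1' Z" "mH \<cdot> h1p = g1p \<cdot> m1H"
    using mH'(1) by (elim pullbackE) (auto simp: hom_def)
  from pbH2 obtain P2' G2' where h2: "h2m \<in> hom C P2' HH" "m2H \<in> hom C P2' G2'"
    "g2m \<in> hom C G2' Z" "mH \<cdot> h2m = g2m \<cdot> m2H"
    using mH'(1) by (elim pullbackE) (auto simp: hom_def)
  from P h1 h2 obtain PP where p: "p' \<in> hom C PP P1'" "p'' \<in> hom C PP P2'" "h1p \<cdot> p' = h2m \<cdot> p''"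
    by (elim pullbackE) (auto simp: hom_def)
  \<comment> \<open>The apex \<open>G\<close> of this pullback is the witness for the intermediate
    object of the composed rewriting.\<close>
  obtain b a where ba: "is_pullback C b a g2m g1p"
    using has_pullbacks[of g2m g1p] h1 h2 by (auto simp: hom_def)
  with h1 h2 obtain G where G: "b \<in> hom C G G2'" "a \<in> hom C G G1'"
    by (elim pullbackE) (auto simp: hom_def)
  have "g2m \<cdot> (m2H \<cdot> p'') = g1p \<cdot> (m1H \<cdot> p')"
    using comp_assoc[OF p(1) h1(1) mH'(1)] comp_assoc[OF p(1) h1(2,3)] h1(4) p(3)
      comp_assoc[OF p(2) h2(1) mH'(1)] comp_assoc[OF p(2) h2(2,3)] h2(4) by simp
  then obtain mm where mm: "mm \<in> hom C PP G" "b \<cdot> mm = m2H \<cdot> p''" "a \<cdot> mm = m1H \<cdot> p'"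
    by (rule pullback_lift[OF ba G comp_hom[OF p(2) h2(2)] comp_hom[OF p(1) h1(2)]])
  \<comment> \<open>Base change along \<open>g1p\<close> of the final pullback complement
    \<open>fH2\<close> of the second step.\<close>
  have fG: "final_pbc C p' m1H mm a"
    by (rule final_pbc_stable[OF fH2 pbH1 ba is_pullback_sym[OF P]
          commuting_squareI[OF p(1) mm(1) h1(2) G(2) mm(3)[symmetric]] mm(2)])
  note pbG = final_pbc_pullback[OF fG]
  \<comment> \<open>Base change along \<open>g2m\<close> of the pushout \<open>poH\<close>; pasting
    with \<open>poR\<close> then reaches the result of the second step.\<close>
  have "is_pushout C mm p'' b m2H"
    by (rule pushout_stable[OF poH m1H_mono commuting_squareI[OF mm(1) p(2) G(1) h2(2) mm(2)]
          is_pullback_sym[OF pbG] is_pullback_sym[OF P] ba is_pullback_sym[OF pbH2]])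
  then have po: "is_pushout C mm (h2p \<cdot> p'') (g2p \<cdot> b) mR"
    by (rule pushout_paste[OF _ is_pushout_sym[OF poR]])
  have f: "final_pbc C (h1m \<cdot> p') m mm (g1m \<cdot> a)"
    by (rule final_pbc_compose[OF fL fG])
  have "rule_instance C (h1m \<cdot> p') (h2p \<cdot> p'') m"
    using f po m_mono
    by (auto simp: final_pbc_def is_pullback_def is_pushout_def commuting_square_def
        rule_instance_def rule_def)
  with f po have rw: "sqpo_rewriting C (h1m \<cdot> p') (h2p \<cdot> p'') m mm (g1m \<cdot> a) (g2p \<cdot> b) mR"
    by (simp add: sqpo_rewriting_def)
  have "Cod C (g1m \<cdot> a) = Cod C m1"
    using f m by (auto simp: final_pbc_def is_pullback_def commuting_square_def is_the_unique_def hom_def)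
  moreover have "Cod C (g2p \<cdot> b) = Cod C g2p"
    using poR h2 G by (elim pushoutE) (auto simp: cat_simps)
  moreover have "monomorphism C mm" by (rule mono_pullback[OF pbG m1H_mono])
  ultimately have ex: "\<exists>mm gm gp mp.
      sqpo_rewriting C (h1m \<cdot> p') (h2p \<cdot> p'') m mm gm gp mp \<and>
      Cod C gm = Cod C m1 \<and> Cod C gp = Cod C g2p \<and>
      monomorphism C mm \<and> monomorphism C mp"
    using rw mR_mono by blast
  show ?thesis
    by (rule exI[of _ mH], rule exI[of _ m1H], rule exI[of _ m], intro conjI mH m1H m m_mono ex)
qed

end
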